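(* Let $W_\alpha$ be a (bounded) weighted shift with positive weight sequence $\alpha=(\alpha_n)_{n\ge0}$. If $\alpha$ is log completely alternating (equivalently, if $(\alpha_n^2)_{n\ge0}$ is log completely alternating), then $W_\alpha$ is moment infinitely divisible (and therefore subnormal).
   Context: For a bounded sequence $\alpha=(\alpha_n)_{n\ge 0}$ of positive numbers, the weighted shift $W_\alpha$ on $\ell^2(\mathbb{N}_0)$ (canonical basis $e_0,e_1,\dots$) is the bounded linear operator with $W_\alpha e_n=\alpha_n e_{n+1}$. An operator is subnormal if it is the restriction of a normal operator to a closed invariant subspace. $W_\alpha$ is moment infinitely divisible (written $W_\alpha\in\mathcal{MID}$) if for every $p\ge 0$ the weighted shift $W_\alpha^{(p)}$ with weights $(\alpha_n^p)_{n\ge0}$ is subnormal. A sequence $a=(a_j)_{j\ge0}$ of positive numbers is log completely alternating if $\sum_{i=0}^n(-1)^i\binom{n}{i}\ln a_{k+i}\le 0$ for all $n\ge 1$ and $k\ge 0$. *)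

theory Defs
  imports "HOL-Analysis.Analysis" "HOL-Algebra.Module"
begin

section \<open>Complex Hilbert spaces with explicit carriers\<close>

text \<open>Subnormality quantifies existentially over Hilbert spaces, so these are modules with an
  explicit carrier (a record) rather than types of some class.\<close>

definition complex_ring :: "complex ring" where
  "complex_ring = \<lparr>carrier = UNIV, monoid.mult = (*), one = 1, ring.zero = 0, add = (+)\<rparr>"

text \<open>The fields \<open>mult\<close> and \<open>one\<close>, inherited from the record of modules, carry no meaning.\<close>

record 'a inner_space = "(complex, 'a) module" +
  cinner :: "'a \<Rightarrow> 'a \<Rightarrow> complex"

definition hnorm :: "('a, 'm) inner_space_scheme \<Rightarrow> 'a \<Rightarrow> real" where
  "hnorm H x = sqrt (Re (cinner H x x))"

text \<open>Outside the carrier the distance is 0, because the locale \<open>Metric_space\<close> asks for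
  nonnegativity and symmetry on the whole type.\<close>

definition hdist :: "('a, 'm) inner_space_scheme \<Rightarrow> 'a \<Rightarrow> 'a \<Rightarrow> real" where
  "hdist H x y = (if x \<in> carrier H \<and> y \<in> carrier H then hnorm H (x \<ominus>\<^bsub>H\<^esub> y) else 0)"

text \<open>The inner product is linear in the first argument.\<close>

locale hilbert_space = Module.module complex_ring H
  for H :: "('a, 'm) inner_space_scheme" (structure) +
  assumes cinner_add: "\<lbrakk>x \<in> carrier H; y \<in> carrier H; z \<in> carrier H\<rbrakk>
      \<Longrightarrow> cinner H (x \<oplus> y) z = cinner H x z + cinner H y z"
    and cinner_smult: "\<lbrakk>x \<in> carrier H; y \<in> carrier H\<rbrakk>
      \<Longrightarrow> cinner H (c \<odot> x) y = c * cinner H x y"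
    and cinner_commute: "\<lbrakk>x \<in> carrier H; y \<in> carrier H\<rbrakk>
      \<Longrightarrow> cinner H y x = cnj (cinner H x y)"
    and cinner_nonneg: "x \<in> carrier H \<Longrightarrow> 0 \<le> Re (cinner H x x)"
    and cinner_definite: "\<lbrakk>x \<in> carrier H; cinner H x x = 0\<rbrakk> \<Longrightarrow> x = \<zero>"
    and complete: "Metric_space.mcomplete (carrier H) (hdist H)"

definition linear_map :: "('a, 'm) inner_space_scheme \<Rightarrow> ('b, 'n) inner_space_scheme
    \<Rightarrow> ('a \<Rightarrow> 'b) \<Rightarrow> bool" where
  "linear_map H K T \<longleftrightarrow> T \<in> carrier H \<rightarrow> carrier K \<and>
     (\<forall>x\<in>carrier H. \<forall>y\<in>carrier H. T (x \<oplus>\<^bsub>H\<^esub> y) = T x \<oplus>\<^bsub>K\<^esub> T y) \<and>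
     (\<forall>c. \<forall>x\<in>carrier H. T (c \<odot>\<^bsub>H\<^esub> x) = c \<odot>\<^bsub>K\<^esub> T x)"

definition bounded_operator :: "('a, 'm) inner_space_scheme \<Rightarrow> ('a \<Rightarrow> 'a) \<Rightarrow> bool" where
  "bounded_operator H T \<longleftrightarrow> linear_map H H T \<and>
     (\<exists>B. \<forall>x\<in>carrier H. hnorm H (T x) \<le> B * hnorm H x)"

definition adjoint_operator ::
    "('a, 'm) inner_space_scheme \<Rightarrow> ('a \<Rightarrow> 'a) \<Rightarrow> ('a \<Rightarrow> 'a) \<Rightarrow> bool" where
  "adjoint_operator H T A \<longleftrightarrow> bounded_operator H A \<and>
     (\<forall>x\<in>carrier H. \<forall>y\<in>carrier H. cinner H (T x) y = cinner H x (A y))"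

definition normal_operator :: "('a, 'm) inner_space_scheme \<Rightarrow> ('a \<Rightarrow> 'a) \<Rightarrow> bool" where
  "normal_operator H N \<longleftrightarrow> bounded_operator H N \<and>
     (\<exists>A. adjoint_operator H N A \<and> (\<forall>x\<in>carrier H. N (A x) = A (N x)))"

definition closed_subspace :: "('a, 'm) inner_space_scheme \<Rightarrow> 'a set \<Rightarrow> bool" where
  "closed_subspace H M \<longleftrightarrow> submodule M complex_ring H \<and>
     closedin (Metric_space.mtopology (carrier H) (hdist H)) M"

definition unitary_map :: "('a, 'm) inner_space_scheme \<Rightarrow> ('b, 'n) inner_space_scheme
    \<Rightarrow> ('a \<Rightarrow> 'b) \<Rightarrow> bool" where
  "unitary_map H K U \<longleftrightarrow> linear_map H K U \<and> bij_betw U (carrier H) (carrier K) \<and>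
     (\<forall>x\<in>carrier H. \<forall>y\<in>carrier H. cinner K (U x) (U y) = cinner H x y)"

text \<open>The restriction of a normal operator \<open>N\<close> on \<open>K\<close> to a closed invariant subspace \<open>M\<close>, where
  \<open>H\<close> is identified with \<open>M\<close> by a unitary map \<open>U\<close>. The carrier of \<open>K\<close> lies in the same type as
  that of \<open>H\<close>. This is no restriction: if \<open>H\<close> is finite-dimensional, a subnormal \<open>T\<close> is normal and
  \<open>K = H\<close> will do; otherwise the minimal normal extension acts on a Hilbert space of the same
  dimension as \<open>H\<close>, which is thus isomorphic to \<open>H\<close>.\<close>

definition subnormal_operator :: "'a inner_space \<Rightarrow> ('a \<Rightarrow> 'a) \<Rightarrow> bool" where
  "subnormal_operator H T \<longleftrightarrow> bounded_operator H T \<and>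
     (\<exists>(K :: 'a inner_space) N M U.
        hilbert_space K \<and> normal_operator K N \<and>
        closed_subspace K M \<and> N ` M \<subseteq> M \<and>
        unitary_map H (K\<lparr>carrier := M\<rparr>) U \<and> (\<forall>x\<in>carrier H. U (T x) = N (U x)))"


section \<open>Weighted shifts\<close>

definition ell2 :: "(nat \<Rightarrow> complex) inner_space" where
  "ell2 = \<lparr>carrier = {x. summable (\<lambda>n. (cmod (x n))\<^sup>2)}, monoid.mult = undefined, one = undefined,
     ring.zero = (\<lambda>_. 0), add = (\<lambda>x y n. x n + y n), smult = (\<lambda>c x n. c * x n),
     cinner = (\<lambda>x y. \<Sum>n. x n * cnj (y n))\<rparr>"

definition weighted_shift :: "(nat \<Rightarrow> real) \<Rightarrow> (nat \<Rightarrow> complex) \<Rightarrow> (nat \<Rightarrow> complex)" where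
  "weighted_shift \<alpha> x = (\<lambda>n. case n of 0 \<Rightarrow> 0 | Suc m \<Rightarrow> of_real (\<alpha> m) * x m)"

definition moment_infinitely_divisible :: "(nat \<Rightarrow> real) \<Rightarrow> bool" where
  "moment_infinitely_divisible \<alpha> \<longleftrightarrow>
     (\<forall>p\<ge>0. subnormal_operator ell2 (weighted_shift (\<lambda>n. \<alpha> n powr p)))"

definition log_completely_alternating :: "(nat \<Rightarrow> real) \<Rightarrow> bool" where
  "log_completely_alternating a \<longleftrightarrow>
     (\<forall>n\<ge>1. \<forall>k. (\<Sum>i=0..n. (-1) ^ i * real (n choose i) * ln (a (k + i))) \<le> 0)"


section \<open>Sanity of the definitions\<close>

definition basis_vec :: "nat \<Rightarrow> nat \<Rightarrow> complex" where
  "basis_vec k = (\<lambda>n. if n = k then 1 else 0)"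

lemma weighted_shift_basis:
  "weighted_shift \<alpha> (basis_vec n) = of_real (\<alpha> n) \<odot>\<^bsub>ell2\<^esub> basis_vec (Suc n)"
  by (auto simp: weighted_shift_def basis_vec_def ell2_def fun_eq_iff split: nat.split)

lemma cring_complex_ring: "cring complex_ring"
proof (rule cringI)
  show "abelian_group complex_ring"
    by (rule abelian_groupI)
      (auto simp: complex_ring_def algebra_simps intro: exI[of _ "- _"] add.left_inverse)
  show "comm_monoid complex_ring"
    by (rule comm_monoidI) (auto simp: complex_ring_def)
qed (auto simp: complex_ring_def algebra_simps)

lemma ell2_summable_add:
  fixes x y :: "nat \<Rightarrow> complex"
  assumes "summable (\<lambda>n. (cmod (x n))\<^sup>2)" "summable (\<lambda>n. (cmod (y n))\<^sup>2)"
  shows "summable (\<lambda>n. (cmod (x n + y n))\<^sup>2)"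
proof (rule summable_comparison_test'[where N = 0])
  show "summable (\<lambda>n. 2 * (cmod (x n))\<^sup>2 + 2 * (cmod (y n))\<^sup>2)"
    using assms by (intro summable_add summable_mult)
  fix n
  have "(cmod (x n + y n))\<^sup>2 \<le> (cmod (x n) + cmod (y n))\<^sup>2"
    by (intro power_mono norm_triangle_ineq) auto
  also have "\<dots> \<le> 2 * (cmod (x n))\<^sup>2 + 2 * (cmod (y n))\<^sup>2"
    using sum_squares_bound[of "cmod (x n)" "cmod (y n)"] by (simp add: power2_sum)
  finally show "norm ((cmod (x n + y n))\<^sup>2) \<le> 2 * (cmod (x n))\<^sup>2 + 2 * (cmod (y n))\<^sup>2"
    by simp
qed

lemma ell2_summable_cinner:
  fixes x y :: "nat \<Rightarrow> complex"
  assumes "summable (\<lambda>n. (cmod (x n))\<^sup>2)" "summable (\<lambda>n. (cmod (y n))\<^sup>2)"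
  shows "summable (\<lambda>n. x n * cnj (y n))"
proof (rule summable_comparison_test'[where N = 0])
  show "summable (\<lambda>n. (cmod (x n))\<^sup>2 + (cmod (y n))\<^sup>2)"
    using assms by (intro summable_add)
  fix n
  have "2 * (cmod (x n) * cmod (y n)) \<le> (cmod (x n))\<^sup>2 + (cmod (y n))\<^sup>2"
    using sum_squares_bound[of "cmod (x n)" "cmod (y n)"] by (simp add: mult.assoc)
  moreover have "0 \<le> cmod (x n) * cmod (y n)" by simp
  ultimately show "norm (x n * cnj (y n)) \<le> (cmod (x n))\<^sup>2 + (cmod (y n))\<^sup>2"
    unfolding norm_mult complex_mod_cnj by linarith
qed

lemma module_ell2: "Module.module complex_ring ell2"
proof (rule Module.moduleI)
  show "cring complex_ring" by (rule cring_complex_ring)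
  show "abelian_group ell2"
  proof (rule abelian_groupI)
    fix x assume "x \<in> carrier ell2"
    then show "\<exists>y\<in>carrier ell2. y \<oplus>\<^bsub>ell2\<^esub> x = \<zero>\<^bsub>ell2\<^esub>"
      by (intro bexI[of _ "\<lambda>n. - x n"]) (auto simp: ell2_def)
  qed (auto simp: ell2_def ell2_summable_add algebra_simps)
qed (auto simp: ell2_def complex_ring_def algebra_simps norm_mult power_mult_distrib
      intro!: summable_mult)

lemma ell2_minus:
  assumes "x \<in> carrier ell2" "y \<in> carrier ell2"
  shows "x \<ominus>\<^bsub>ell2\<^esub> y = (\<lambda>n. x n - y n)"
proof -
  interpret Module.module complex_ring ell2 by (rule module_ell2)
  have y': "(\<lambda>n. - y n) \<in> carrier ell2" using assms by (auto simp: ell2_def)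
  have "\<ominus>\<^bsub>ell2\<^esub> y = (\<lambda>n. - y n)"
    by (rule M.minus_equality) (use assms y' in \<open>auto simp: ell2_def\<close>)
  then show ?thesis by (simp add: a_minus_def) (simp add: ell2_def)
qed

lemma ell2_hnorm:
  assumes "x \<in> carrier ell2"
  shows "hnorm ell2 x = sqrt (\<Sum>n. (cmod (x n))\<^sup>2)"
proof -
  have "(\<lambda>n. x n * cnj (x n)) = (\<lambda>n. of_real ((cmod (x n))\<^sup>2))"
    by (intro ext) (rule complex_norm_square[symmetric])
  moreover have "summable (\<lambda>n. (cmod (x n))\<^sup>2)" using assms by (simp add: ell2_def)
  ultimately show ?thesis
    by (simp add: hnorm_def ell2_def suminf_of_real[symmetric] del: of_real_power)
qed

lemma ell2_cinner_self:
  assumes "x \<in> carrier ell2"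
  shows "cinner ell2 x x = of_real (\<Sum>n. (cmod (x n))\<^sup>2)"
proof -
  have "(\<lambda>n. x n * cnj (x n)) = (\<lambda>n. of_real ((cmod (x n))\<^sup>2))"
    by (intro ext) (rule complex_norm_square[symmetric])
  moreover have "summable (\<lambda>n. (cmod (x n))\<^sup>2)" using assms by (simp add: ell2_def)
  ultimately show ?thesis
    by (simp add: ell2_def suminf_of_real[symmetric] del: of_real_power)
qed

lemma ell2_norm_bound_iff:
  assumes "0 \<le> e"
  shows "x \<in> carrier ell2 \<and> hnorm ell2 x \<le> e \<longleftrightarrow> (\<forall>N. (\<Sum>n<N. (cmod (x n))\<^sup>2) \<le> e\<^sup>2)"
proof
  assume L: "x \<in> carrier ell2 \<and> hnorm ell2 x \<le> e"
  then have s: "summable (\<lambda>n. (cmod (x n))\<^sup>2)" by (simp add: ell2_def)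
  have "(\<Sum>n. (cmod (x n))\<^sup>2) \<le> e\<^sup>2"
    using L assms ell2_hnorm[of x] by (simp add: sqrt_le_D)
  then show "\<forall>N. (\<Sum>n<N. (cmod (x n))\<^sup>2) \<le> e\<^sup>2"
    using sum_le_suminf[OF s] by (meson finite_lessThan order_trans zero_le_power2)
next
  assume R: "\<forall>N. (\<Sum>n<N. (cmod (x n))\<^sup>2) \<le> e\<^sup>2"
  then have s: "summable (\<lambda>n. (cmod (x n))\<^sup>2)"
    by (intro summableI_nonneg_bounded) auto
  then have "(\<Sum>n. (cmod (x n))\<^sup>2) \<le> e\<^sup>2"
    using R by (intro suminf_le_const) auto
  with s assms show "x \<in> carrier ell2 \<and> hnorm ell2 x \<le> e"
    using ell2_hnorm[of x] by (simp add: ell2_def real_le_lsqrt)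
qed

lemma Metric_space_ell2: "Metric_space (carrier ell2) (hdist ell2)"
proof -
  interpret Module.module complex_ring ell2 by (rule module_ell2)
  have d: "hdist ell2 x y = sqrt (\<Sum>n. (cmod (x n - y n))\<^sup>2)"
    and s: "summable (\<lambda>n. (cmod (x n - y n))\<^sup>2)"
    if "x \<in> carrier ell2" "y \<in> carrier ell2" for x y
  proof -
    have m: "x \<ominus>\<^bsub>ell2\<^esub> y \<in> carrier ell2" using that by simp
    then show "hdist ell2 x y = sqrt (\<Sum>n. (cmod (x n - y n))\<^sup>2)"
      using that by (simp add: hdist_def ell2_hnorm ell2_minus)
    from m show "summable (\<lambda>n. (cmod (x n - y n))\<^sup>2)"
      unfolding ell2_minus[OF that] by (simp add: ell2_def)
  qed
  show ?thesis
  proof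
    fix x y
    show "0 \<le> hdist ell2 x y"
      by (cases "x \<in> carrier ell2 \<and> y \<in> carrier ell2")
        (auto simp: d s suminf_nonneg, auto simp: hdist_def)
    show "hdist ell2 x y = hdist ell2 y x"
      by (cases "x \<in> carrier ell2 \<and> y \<in> carrier ell2")
        (auto simp: d norm_minus_commute, auto simp: hdist_def)
  next
    fix x y assume "x \<in> carrier ell2" "y \<in> carrier ell2"
    then show "hdist ell2 x y = 0 \<longleftrightarrow> x = y"
      by (auto simp: d suminf_eq_zero_iff[OF s] fun_eq_iff)
  next
    fix x y z assume A: "x \<in> carrier ell2" "y \<in> carrier ell2" "z \<in> carrier ell2"
    have lim: "(\<lambda>N. L2_set (\<lambda>n. cmod (u n - v n)) {..<N}) \<longlonglongrightarrow> hdist ell2 u v"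
      if "u \<in> carrier ell2" "v \<in> carrier ell2" for u v
      unfolding L2_set_def d[OF that] by (intro tendsto_real_sqrt summable_LIMSEQ s that)
    have le: "L2_set (\<lambda>n. cmod (x n - z n)) {..<N} \<le>
        L2_set (\<lambda>n. cmod (x n - y n)) {..<N} + L2_set (\<lambda>n. cmod (y n - z n)) {..<N}" for N
    proof -
      have "L2_set (\<lambda>n. cmod (x n - z n)) {..<N} \<le>
          L2_set (\<lambda>n. cmod (x n - y n) + cmod (y n - z n)) {..<N}"
        by (intro L2_set_mono) (auto intro: norm_triangle_sub order_trans[OF _ norm_triangle_ineq])
      also have "\<dots> \<le> L2_set (\<lambda>n. cmod (x n - y n)) {..<N} + L2_set (\<lambda>n. cmod (y n - z n)) {..<N}"
        by (rule L2_set_triangle_ineq)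
      finally show ?thesis .
    qed
    show "hdist ell2 x z \<le> hdist ell2 x y + hdist ell2 y z"
      by (rule LIMSEQ_le[OF lim tendsto_add[OF lim lim]]) (use A le in auto)
  qed
qed

lemma mcomplete_ell2: "Metric_space.mcomplete (carrier ell2) (hdist ell2)"
proof -
  interpret module: Module.module complex_ring ell2 by (rule module_ell2)
  interpret Metric_space "carrier ell2" "hdist ell2" by (rule Metric_space_ell2)
  have bnd: "(\<Sum>n<N. (cmod (x n - y n))\<^sup>2) \<le> e\<^sup>2"
    if "x \<in> carrier ell2" "y \<in> carrier ell2" "hdist ell2 x y \<le> e" for x y e N
  proof -
    have "0 \<le> e" using that nonneg[of x y] by linarith
    moreover have "(\<lambda>n. x n - y n) \<in> carrier ell2"
      using module.M.minus_closed[OF that(1,2)] unfolding ell2_minus[OF that(1,2)] .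
    moreover have "hnorm ell2 (\<lambda>n. x n - y n) \<le> e"
      using that(3) unfolding hdist_def ell2_minus[OF that(1,2)] using that(1,2) by simp
    ultimately show ?thesis
      using ell2_norm_bound_iff[of e "\<lambda>n. x n - y n"] by blast
  qed
  show ?thesis
    unfolding mcomplete_def
  proof (intro allI impI)
    fix \<sigma> assume "MCauchy \<sigma>"
    then have \<sigma>: "\<And>m. \<sigma> m \<in> carrier ell2"
      and C: "\<And>e. e > 0 \<Longrightarrow> \<exists>N. \<forall>m n. N \<le> m \<longrightarrow> N \<le> n \<longrightarrow> hdist ell2 (\<sigma> m) (\<sigma> n) < e"
      by (auto simp: MCauchy_def)
    have "Cauchy (\<lambda>m. \<sigma> m k)" for k
    proof (rule metric_CauchyI)
      fix e :: real assume "e > 0"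
      then obtain N where N: "\<And>m n. N \<le> m \<Longrightarrow> N \<le> n \<Longrightarrow> hdist ell2 (\<sigma> m) (\<sigma> n) < e / 2"
        using C[of "e / 2"] by auto
      have "dist (\<sigma> m k) (\<sigma> n k) < e" if "N \<le> m" "N \<le> n" for m n
      proof -
        have "(cmod (\<sigma> m k - \<sigma> n k))\<^sup>2 \<le> (\<Sum>i<Suc k. (cmod (\<sigma> m i - \<sigma> n i))\<^sup>2)"
          by (rule member_le_sum) auto
        also have "\<dots> \<le> (e / 2)\<^sup>2"
          using bnd \<sigma> N[OF that] less_imp_le by blast
        finally have "cmod (\<sigma> m k - \<sigma> n k) \<le> e / 2"
          using \<open>e > 0\<close> by (simp add: power2_le_iff_abs_le)
        then show ?thesis using \<open>e > 0\<close> by (simp add: dist_norm)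
      qed
      then show "\<exists>M. \<forall>m\<ge>M. \<forall>n\<ge>M. dist (\<sigma> m k) (\<sigma> n k) < e" by blast
    qed
    then have "\<forall>k. \<exists>l. (\<lambda>m. \<sigma> m k) \<longlonglongrightarrow> l"
      by (simp add: Cauchy_convergent_iff convergent_def)
    then obtain x where x: "\<And>k. (\<lambda>m. \<sigma> m k) \<longlonglongrightarrow> x k" by metis
    have conv: "\<exists>N. \<forall>m\<ge>N. (\<lambda>n. \<sigma> m n - x n) \<in> carrier ell2 \<and>
        hnorm ell2 (\<lambda>n. \<sigma> m n - x n) \<le> e" if e: "e > 0" for e
    proof -
      obtain N where N: "\<And>m n. N \<le> m \<Longrightarrow> N \<le> n \<Longrightarrow> hdist ell2 (\<sigma> m) (\<sigma> n) < e"
        using C[OF e] by auto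
      have "(\<Sum>n<J. (cmod (\<sigma> m n - x n))\<^sup>2) \<le> e\<^sup>2" if "N \<le> m" for m J
      proof (rule LIMSEQ_le_const2)
        show "(\<lambda>l. \<Sum>n<J. (cmod (\<sigma> m n - \<sigma> l n))\<^sup>2) \<longlonglongrightarrow> (\<Sum>n<J. (cmod (\<sigma> m n - x n))\<^sup>2)"
          by (intro tendsto_intros x)
        show "\<exists>L. \<forall>l\<ge>L. (\<Sum>n<J. (cmod (\<sigma> m n - \<sigma> l n))\<^sup>2) \<le> e\<^sup>2"
          using bnd \<sigma> N[OF that] less_imp_le by blast
      qed
      then show ?thesis
        using ell2_norm_bound_iff[of e] e by (intro exI[of _ N]) (simp add: less_imp_le)
    qed
    have xc: "x \<in> carrier ell2"
    proof -
      obtain m where m: "(\<lambda>n. \<sigma> m n - x n) \<in> carrier ell2" using conv[of 1] by auto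
      have "\<sigma> m \<ominus>\<^bsub>ell2\<^esub> (\<lambda>n. \<sigma> m n - x n) \<in> carrier ell2"
        using \<sigma> m by simp
      then show ?thesis by (simp add: ell2_minus[OF \<sigma> m])
    qed
    have "limitin mtopology \<sigma> x sequentially"
      unfolding limitin_metric
    proof (intro conjI allI impI)
      fix e :: real assume "e > 0"
      then obtain N where "\<And>m. m \<ge> N \<Longrightarrow> hnorm ell2 (\<lambda>n. \<sigma> m n - x n) \<le> e / 2"
        using conv[of "e / 2"] by auto
      then have "\<forall>m\<ge>N. hdist ell2 (\<sigma> m) x < e"
        using \<sigma> xc \<open>e > 0\<close> by (fastforce simp: hdist_def ell2_minus)
      then show "\<forall>\<^sub>F m in sequentially. \<sigma> m \<in> carrier ell2 \<and> hdist ell2 (\<sigma> m) x < e"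
        using \<sigma> by (auto simp: eventually_sequentially)
    qed (rule xc)
    then show "\<exists>x. limitin mtopology \<sigma> x sequentially" by blast
  qed
qed

lemma hilbert_space_ell2: "hilbert_space ell2"
proof (intro hilbert_space.intro hilbert_space_axioms.intro)
  fix x y z c
  assume A: "x \<in> carrier ell2" "y \<in> carrier ell2"
  then have s: "summable (\<lambda>n. x n * cnj (y n))"
    by (auto simp: ell2_def intro: ell2_summable_cinner)
  show "cinner ell2 (c \<odot>\<^bsub>ell2\<^esub> x) y = c * cinner ell2 x y"
    using suminf_mult[OF s, of c] by (simp add: ell2_def mult.assoc)
  show "cinner ell2 y x = cnj (cinner ell2 x y)"
    using sums_unique[OF sums_cnj[THEN iffD2, OF summable_sums[OF s]]]
    by (simp add: ell2_def mult.commute)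
  assume "z \<in> carrier ell2"
  with A have "summable (\<lambda>n. x n * cnj (z n))" "summable (\<lambda>n. y n * cnj (z n))"
    by (auto simp: ell2_def intro: ell2_summable_cinner)
  then show "cinner ell2 (x \<oplus>\<^bsub>ell2\<^esub> y) z = cinner ell2 x z + cinner ell2 y z"
    by (simp add: ell2_def algebra_simps suminf_add)
next
  fix x assume A: "x \<in> carrier ell2"
  then have s: "summable (\<lambda>n. (cmod (x n))\<^sup>2)" by (simp add: ell2_def)
  show "0 \<le> Re (cinner ell2 x x)"
    using A s by (simp add: ell2_cinner_self suminf_nonneg)
  assume "cinner ell2 x x = 0"
  then have "\<forall>n. x n = 0"
    using A by (simp add: ell2_cinner_self suminf_eq_zero_iff[OF s])
  then show "x = \<zero>\<^bsub>ell2\<^esub>" by (simp add: ell2_def fun_eq_iff)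
qed (rule module_ell2 mcomplete_ell2)+

end

theory Submission
  imports Defs "HOL-Computational_Algebra.Polynomial"
begin

text \<open>Why the theorem is true. The logarithm of \<open>\<alpha> n powr p\<close> is \<open>p * ln (\<alpha> n)\<close>, so the hypothesis
  passes to all powers with \<open>p \<ge> 0\<close>, and it suffices to show that the shift itself is subnormal.

  \<^emph>\<open>Moments.\<close> Let \<open>s\<close> bound the weights and put \<open>g n = (\<Prod>k<n. (\<alpha> k / s)\<^sup>2)\<close>. Then \<open>- ln (g n)\<close> is a
  completely alternating sequence: its first difference is, up to a constant, \<open>ln\<close> of the squared
  weights. The exponential of the negative of a completely alternating sequence is completely
  monotone (\<open>completely_monotone_exp_minus\<close>), so \<open>g\<close> is a Hausdorff moment sequence. Instead of the
  representing measure, the proof uses the discrete measures that Bernstein's operators attach to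
  \<open>g\<close> (\<open>hausdorff_moment_approximation\<close>): they show that the linear functional on polynomials whose
  even moments are \<open>\<Prod>k<n. (\<alpha> k)\<^sup>2\<close> and whose odd moments vanish is nonnegative on polynomials that are
  nonnegative on \<open>[-s, s]\<close> (\<open>symmetric_moment_functional_nonneg\<close>).

  \<^emph>\<open>A self-adjoint operator.\<close> Orthonormalising the powers of \<open>X\<close> for this functional (Lanczos,
  locale \<open>positive_functional\<close>) gives a bounded Jacobi matrix \<open>J\<close> and a unit vector \<open>e\<close> such that the
  norm of \<open>(J ^ n) e\<close> is \<open>\<Prod>k<n. \<alpha> k\<close>.

  \<^emph>\<open>The normal extension.\<close> On square-summable functions on \<open>int \<times> int\<close>, the tensor product \<open>N\<close> of the
  bilateral shift with \<open>J\<close> is normal, as \<open>J\<close> is self-adjoint. It maps \<open>\<delta> n \<otimes> (J ^ n) e\<close> to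
  \<open>\<delta> (n + 1) \<otimes> (J ^ (n + 1)) e\<close>. For \<open>n \<ge> 0\<close> these vectors are orthogonal and have norms
  \<open>\<Prod>k<n. \<alpha> k\<close>, so on their closed span \<open>N\<close> is unitarily equivalent to the weighted shift
  (\<open>subnormal_if_jacobi_orbit\<close>). Enumerating \<open>int \<times> int\<close> by \<open>nat\<close> lets \<open>ell2\<close> itself be the larger
  Hilbert space.\<close>


section \<open>Completely monotone sequences\<close>

definition nabla :: "(nat \<Rightarrow> real) \<Rightarrow> nat \<Rightarrow> real" where
  "nabla f k = f k - f (Suc k)"

lemma nabla_pow_Suc: "(nabla ^^ Suc n) f k = (nabla ^^ n) f k - (nabla ^^ n) f (Suc k)"
  by (simp add: nabla_def)

lemma nabla_pow_shift: "(nabla ^^ n) (\<lambda>k. f (Suc k)) k = (nabla ^^ n) f (Suc k)"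
  by (induction n arbitrary: k) (simp_all add: nabla_def)

lemma nabla_pow_add: "(nabla ^^ n) (\<lambda>k. f k + g k) k = (nabla ^^ n) f k + (nabla ^^ n) g k"
  by (induction n arbitrary: k) (simp_all add: nabla_def)

lemma nabla_pow_cmult: "(nabla ^^ n) (\<lambda>k. c * f k) k = c * (nabla ^^ n) f k"
  by (induction n arbitrary: k) (simp_all add: nabla_def algebra_simps)

lemma nabla_pow_const: "n \<ge> 1 \<Longrightarrow> (nabla ^^ n) (\<lambda>k. c) k = 0"
proof (induction n arbitrary: k)
  case (Suc n)
  then show ?case by (cases n) (simp_all add: nabla_def)
qed simp

lemma nabla_pow_tendsto:
  assumes "\<And>k. (\<lambda>m. F m k) \<longlonglongrightarrow> f k"
  shows "(\<lambda>m. (nabla ^^ n) (F m) k) \<longlonglongrightarrow> (nabla ^^ n) f k"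
  by (induction n arbitrary: k) (simp_all add: nabla_def assms tendsto_diff)

text \<open>The finite range is needed because the approximants \<open>1 - \<psi> k / m\<close> of \<open>exp (- \<psi> k / m)\<close> used below
  are nonnegative only for \<open>k\<close> up to a bound that depends on \<open>m\<close>, if \<open>\<psi>\<close> is unbounded.\<close>

definition completely_monotone_upto :: "nat \<Rightarrow> (nat \<Rightarrow> real) \<Rightarrow> bool" where
  "completely_monotone_upto M f \<longleftrightarrow> (\<forall>n k. n + k \<le> M \<longrightarrow> 0 \<le> (nabla ^^ n) f k)"

lemma completely_monotone_upto_Suc: "completely_monotone_upto (Suc M) f \<longleftrightarrow> (\<forall>k\<le>Suc M. 0 \<le> f k) \<and> completely_monotone_upto M (nabla f)"
proof
  assume L: "completely_monotone_upto (Suc M) f"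
  have "0 \<le> (nabla ^^ n) (nabla f) k" if "n + k \<le> M" for n k
    using L that unfolding completely_monotone_upto_def
    by (metis funpow_Suc_right comp_apply add_Suc Suc_le_mono)
  moreover have "\<forall>k\<le>Suc M. 0 \<le> f k"
    using L unfolding completely_monotone_upto_def by (metis add_0 funpow_0)
  ultimately show "(\<forall>k\<le>Suc M. 0 \<le> f k) \<and> completely_monotone_upto M (nabla f)"
    by (simp add: completely_monotone_upto_def)
next
  assume R: "(\<forall>k\<le>Suc M. 0 \<le> f k) \<and> completely_monotone_upto M (nabla f)"
  have "0 \<le> (nabla ^^ n) f k" if "n + k \<le> Suc M" for n k
  proof (cases n)
    case 0
    then show ?thesis using R that by simp
  next
    case (Suc n')
    then have "0 \<le> (nabla ^^ n') (nabla f) k" using R that by (auto simp: completely_monotone_upto_def)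
    then show ?thesis by (simp add: Suc funpow_Suc_right del: funpow.simps)
  qed
  then show "completely_monotone_upto (Suc M) f" by (simp add: completely_monotone_upto_def)
qed

text \<open>By induction on the range, from the product rule for differences:
  \<open>nabla (f * g) k = nabla f k * g k + f (k + 1) * nabla g k\<close>.\<close>

lemma completely_monotone_upto_mult: "completely_monotone_upto M f \<Longrightarrow> completely_monotone_upto M g \<Longrightarrow> completely_monotone_upto M (\<lambda>k. f k * g k)"
proof (induction M arbitrary: f g)
  case 0
  then show ?case by (simp add: completely_monotone_upto_def)
next
  case (Suc M)
  have less: "completely_monotone_upto M h" and shift: "completely_monotone_upto M (\<lambda>k. h (Suc k))" if "completely_monotone_upto (Suc M) h" for h
    using that by (auto simp: completely_monotone_upto_def nabla_pow_shift)
  have "completely_monotone_upto M (\<lambda>k. nabla f k * g k)"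
    using Suc.prems less by (intro Suc.IH) (auto simp: completely_monotone_upto_Suc)
  moreover have "completely_monotone_upto M (\<lambda>k. f (Suc k) * nabla g k)"
    using Suc.prems shift by (intro Suc.IH) (auto simp: completely_monotone_upto_Suc)
  ultimately have "completely_monotone_upto M (\<lambda>k. nabla f k * g k + f (Suc k) * nabla g k)"
    by (auto simp: completely_monotone_upto_def nabla_pow_add)
  also have "(\<lambda>k. nabla f k * g k + f (Suc k) * nabla g k) = nabla (\<lambda>k. f k * g k)"
    by (auto simp: nabla_def algebra_simps)
  finally show ?case
    using Suc.prems by (simp add: completely_monotone_upto_Suc)
qed

lemma completely_monotone_upto_power: "completely_monotone_upto M f \<Longrightarrow> completely_monotone_upto M (\<lambda>k. f k ^ m)"
proof (induction m)
  case 0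
  have "(0::real) \<le> (nabla ^^ n) (\<lambda>k. 1) k" for n k
    by (cases n) (simp_all add: nabla_pow_const del: funpow.simps)
  then show ?case by (simp add: completely_monotone_upto_def)
next
  case (Suc m)
  then show ?case using completely_monotone_upto_mult[of M f "\<lambda>k. f k ^ m"] by simp
qed

text \<open>On any finite range, \<open>1 - \<psi> k / m\<close> is completely monotone for large \<open>m\<close>: its differences of order
  at least 1 are those of \<open>\<psi>\<close> with the sign reversed. So are its powers, and \<open>exp (- \<psi> k)\<close> is the
  limit of \<open>(1 - \<psi> k / m) ^ m\<close>.\<close>

lemma completely_monotone_exp_minus:
  assumes alt: "\<And>n k. n \<ge> 1 \<Longrightarrow> (nabla ^^ n) \<psi> k \<le> 0"
  shows "0 \<le> (nabla ^^ n) (\<lambda>k. exp (- \<psi> k)) k"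
proof -
  define M where "M = n + k"
  define F where "F m k = (1 + (- \<psi> k) / real m) ^ m" for m k
  have lim: "(\<lambda>m. (nabla ^^ n) (F m) k) \<longlonglongrightarrow> (nabla ^^ n) (\<lambda>k. exp (- \<psi> k)) k"
    unfolding F_def by (intro nabla_pow_tendsto tendsto_exp_limit_sequentially)
  obtain B where B: "\<And>j. j \<le> M \<Longrightarrow> \<bar>\<psi> j\<bar> \<le> B"
    using finite_imageI[of "{..M}" "\<lambda>j. \<bar>\<psi> j\<bar>"] Max_ge[of "(\<lambda>j. \<bar>\<psi> j\<bar>) ` {..M}"]
    by (meson atMost_iff finite_atMost imageI)
  have "0 \<le> (nabla ^^ n) (F m) k" if m: "m \<ge> Suc (nat \<lceil>B\<rceil>)" for m
  proof -
    have mB: "B \<le> real m" "0 < real m" using m by linarith+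
    have "0 \<le> (nabla ^^ i) (\<lambda>k. 1 + (- 1 / real m) * \<psi> k) j" if "i + j \<le> M" for i j
    proof (cases "i = 0")
      case True
      have "\<psi> j \<le> real m" using B[of j] that mB by linarith
      then show ?thesis using mB True by (simp add: field_simps)
    next
      case False
      then show ?thesis
        using alt[of i j] mB
        by (simp only: nabla_pow_add nabla_pow_cmult nabla_pow_const)
          (simp add: divide_nonpos_pos)
    qed
    then have "completely_monotone_upto M (\<lambda>k. 1 + (- 1 / real m) * \<psi> k)" by (simp add: completely_monotone_upto_def)
    then have "completely_monotone_upto M (F m)"
      unfolding F_def using completely_monotone_upto_power[of M _ m] by simp
    then show ?thesis by (simp add: completely_monotone_upto_def M_def)
  qed
  then show ?thesis
    by (intro LIMSEQ_le_const[OF lim]) blast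
qed

section \<open>Moment functionals on polynomials\<close>

definition moment_functional :: "(nat \<Rightarrow> real) \<Rightarrow> real poly \<Rightarrow> real" where
  "moment_functional h p = (\<Sum>i\<le>degree p. coeff p i * h i)"

lemma moment_functional_eq_sum:
  "degree p \<le> n \<Longrightarrow> moment_functional h p = (\<Sum>i\<le>n. coeff p i * h i)"
  unfolding moment_functional_def
  by (intro sum.mono_neutral_left) (auto simp: coeff_eq_0)

lemma moment_functional_add:
  "moment_functional h (p + q) = moment_functional h p + moment_functional h q"
proof -
  define n where "n = max (degree p) (degree q)"
  have "degree (p + q) \<le> n" "degree p \<le> n" "degree q \<le> n"
    by (auto simp: n_def degree_add_le)
  then show ?thesis
    by (simp add: moment_functional_eq_sum[of _ n] algebra_simps sum.distrib)
qed

lemma moment_functional_smult: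
  "moment_functional h (Polynomial.smult c p) = c * moment_functional h p"
  by (simp add: moment_functional_eq_sum[of _ "degree p"] sum_distrib_left mult.assoc
      degree_smult_le)

lemma moment_functional_diff:
  "moment_functional h (p - q) = moment_functional h p - moment_functional h q"
  using moment_functional_add[of h p "- q"] moment_functional_smult[of h "-1" q] by simp

lemma moment_functional_0: "moment_functional h 0 = 0"
  by (simp add: moment_functional_def)

lemma moment_functional_sum:
  "moment_functional h (\<Sum>i\<in>I. P i) = (\<Sum>i\<in>I. moment_functional h (P i))"
  by (induction I rule: infinite_finite_induct)
    (simp_all add: moment_functional_0 moment_functional_add)

lemma moment_functional_monom: "moment_functional h (monom c n) = c * h n"
proof -
  have "moment_functional h (monom c n) = (\<Sum>i\<le>n. if i = n then c * h n else 0)"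
    unfolding moment_functional_eq_sum[OF degree_monom_le]
    by (rule sum.cong) auto
  then show ?thesis by simp
qed

text \<open>This turns identities between iterated differences into polynomial identities.\<close>

lemma moment_functional_nabla:
  "moment_functional f (monom 1 k * [:1, -1:] ^ n) = (nabla ^^ n) f k"
proof (induction n arbitrary: k)
  case 0
  then show ?case by (simp add: moment_functional_monom)
next
  case (Suc n)
  have "monom 1 k * [:1, -1:] ^ Suc n
      = monom 1 k * [:1, -1:] ^ n - monom (1::real) (Suc k) * [:1, -1:] ^ n"
    by (simp add: monom_Suc algebra_simps)
  then show ?case
    by (simp only: moment_functional_diff Suc nabla_pow_Suc)
qed

lemma nabla_pow_eq_binomial_sum:
  "(nabla ^^ n) f k = (\<Sum>i=0..n. (-1) ^ i * real (n choose i) * f (k + i))"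
proof -
  have "[:1, -1:] ^ n = (monom (-1) 1 + 1) ^ n"
    by (simp add: monom_altdef one_pCons)
  also have "\<dots> = (\<Sum>i\<le>n. monom ((-1) ^ i * real (n choose i)) i)"
    unfolding binomial_ring
    by (intro sum.cong refl) (simp add: monom_power of_nat_poly smult_monom mult.commute)
  finally have "monom 1 k * [:1, -1:] ^ n
      = (\<Sum>i\<le>n. monom ((-1) ^ i * real (n choose i)) (k + i))"
    by (simp add: sum_distrib_left mult_monom)
  then show ?thesis
    by (simp add: moment_functional_nabla[symmetric] moment_functional_sum moment_functional_monom
        atMost_atLeast0)
qed

section \<open>Discrete approximations of Hausdorff moment sequences\<close>

text \<open>If \<open>g n\<close> is the integral of \<open>t ^ n\<close> for a measure on \<open>[0, 1]\<close>, this is the integral of the Bernstein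
  basis polynomial \<open>(N choose j) * t ^ j * (1 - t) ^ (N - j)\<close>.\<close>

definition bernstein_weight :: "(nat \<Rightarrow> real) \<Rightarrow> nat \<Rightarrow> nat \<Rightarrow> real" where
  "bernstein_weight g N j = real (N choose j) * (nabla ^^ (N - j)) g j"

text \<open>After \<open>(N choose j) * (j choose n) = (N choose n) * ((N - n) choose (j - n))\<close>, this is the functional
  applied to the binomial expansion of \<open>X ^ n * (X + (1 - X)) ^ (N - n) = X ^ n\<close>.\<close>

lemma bernstein_weight_moment:
  assumes "n \<le> N"
  shows "(\<Sum>j\<le>N. bernstein_weight g N j * (real (j choose n) / real (N choose n))) = g n"
proof -
  have "(\<Sum>j\<le>N. bernstein_weight g N j * (real (j choose n) / real (N choose n)))
      = (\<Sum>j=n..N. real ((N - n) choose (j - n)) * (nabla ^^ (N - j)) g j)"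
  proof (rule sum.mono_neutral_cong_right)
    fix j assume j: "j \<in> {n..N}"
    have "real (N choose j) * real (j choose n) = real (N choose n) * real ((N - n) choose (j - n))"
      using choose_mult[of n j N] j by (metis atLeastAtMost_iff of_nat_mult)
    moreover have "real (N choose n) \<noteq> 0" using assms by simp
    ultimately show "bernstein_weight g N j * (real (j choose n) / real (N choose n))
        = real ((N - n) choose (j - n)) * (nabla ^^ (N - j)) g j"
      by (simp add: bernstein_weight_def field_simps)
  qed auto
  also have "\<dots> = (\<Sum>i\<le>N - n. real ((N - n) choose i) * (nabla ^^ (N - n - i)) g (n + i))"
    using assms
    by (intro sum.reindex_bij_witness[of _ "\<lambda>i. n + i" "\<lambda>j. j - n"]) auto
  also have "\<dots> = moment_functional g (\<Sum>i\<le>N - n.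
      Polynomial.smult (real ((N - n) choose i)) (monom 1 (n + i) * [:1, -1:] ^ (N - n - i)))"
    by (simp add: moment_functional_sum moment_functional_smult moment_functional_nabla)
  also have "(\<Sum>i\<le>N - n. Polynomial.smult (real ((N - n) choose i)) (monom 1 (n + i) * [:1, -1:] ^ (N - n - i)))
      = monom 1 n * (monom 1 1 + [:1, -1:]) ^ (N - n)"
    unfolding binomial_ring sum_distrib_left
    by (intro sum.cong refl) (simp add: monom_power mult_monom of_nat_poly flip: mult.assoc)
  also have "monom 1 1 + [:1, -1:] = (1 :: real poly)"
    by (simp add: monom_altdef one_pCons)
  finally show ?thesis by (simp add: moment_functional_monom)
qed

text \<open>Both terms are products of \<open>n\<close> factors in \<open>[0, 1]\<close>, namely \<open>(j - i) / (N - i)\<close> with truncated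
  subtraction and \<open>j / N\<close>. These differ by at most \<open>n / N\<close>, and so the products by at most
  \<open>n * (n / N)\<close>.\<close>

lemma choose_ratio_power_dist:
  assumes "j \<le> N" "n \<le> N" "0 < N"
  shows "\<bar>real (j choose n) / real (N choose n) - (real j / real N) ^ n\<bar> \<le> (real n)\<^sup>2 / real N"
proof -
  have rat: "real (j choose n) / real (N choose n) = (\<Prod>i<n. real (j - i) / real (N - i))"
  proof -
    have N: "real (N choose n) = (\<Prod>i<n. real (N - i)) / fact n"
      using assms by (simp add: binomial_altdef_of_nat[of n N] prod_dividef fact_prod_rev of_nat_diff lessThan_atLeast0)
    have j: "real (j choose n) = (\<Prod>i<n. real (j - i)) / fact n"
    proof (cases "n \<le> j")
      case True
      then show ?thesis
        by (simp add: binomial_altdef_of_nat[of n j] prod_dividef fact_prod_rev of_nat_diff lessThan_atLeast0)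
    next
      case False
      then have "j < n" by simp
      then have "(\<Prod>i<n. real (j - i)) = 0" by (intro prod_zero bexI[of _ j]) auto
      then show ?thesis unfolding binomial_eq_0[OF \<open>j < n\<close>] by (simp only: of_nat_0 div_0)
    qed
    show ?thesis by (simp add: N j prod_dividef)
  qed
  have "\<bar>(\<Prod>i<n. real (j - i) / real (N - i)) - (\<Prod>i<n. real j / real N)\<bar>
      \<le> (\<Sum>i<n. \<bar>real (j - i) / real (N - i) - real j / real N\<bar>)"
    using norm_prod_diff[of "{..<n}" "\<lambda>i. real (j - i) / real (N - i)" "\<lambda>i. real j / real N"] assms
    by (auto simp: divide_le_eq_1)
  also have "\<dots> \<le> (\<Sum>i<n. real n / real N)"
  proof (rule sum_mono)
    fix i assume i: "i \<in> {..<n}"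
    have ni: "real i / real N \<le> real n / real N" using i by (simp add: divide_right_mono)
    show "\<bar>real (j - i) / real (N - i) - real j / real N\<bar> \<le> real n / real N"
    proof (cases "i \<le> j")
      case True
      have p: "0 < real N - real i" "0 < real N" using i assms by auto
      have "real j / real N - real (j - i) / real (N - i)
          = (real i / real N) * ((real N - real j) / (real N - real i))"
        using p True i assms by (simp add: of_nat_diff field_simps)
      moreover have "0 \<le> (real N - real j) / (real N - real i)" "(real N - real j) / (real N - real i) \<le> 1"
        using p True assms by (simp_all add: divide_le_eq_1)
      moreover have "0 \<le> real i / real N" by simp
      ultimately have "0 \<le> real j / real N - real (j - i) / real (N - i)"
        "real j / real N - real (j - i) / real (N - i) \<le> real i / real N"
        by (simp_all only: mult_nonneg_nonneg mult_left_le)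
      moreover have "\<bar>x - y\<bar> \<le> z" if "0 \<le> y - x" "y - x \<le> w" "w \<le> z" for w x y z :: real
        using that by linarith
      ultimately show ?thesis using ni by blast
    next
      case False
      then have "real j / real N \<le> real i / real N" by (simp add: divide_right_mono)
      then show ?thesis using False ni by simp
    qed
  qed
  also have "\<dots> = (real n)\<^sup>2 / real N" by (simp add: power2_eq_square)
  finally show ?thesis by (simp add: rat)
qed

text \<open>The weights at \<open>j / N\<close> have total mass \<open>g 0\<close>, so replacing the ratios of binomial coefficients in
  \<open>bernstein_weight_moment\<close> by powers changes the sum by \<open>O(1 / N)\<close>.\<close>

lemma hausdorff_moment_approximation:
  assumes cm: "\<And>n k. 0 \<le> (nabla ^^ n) g k"
  shows "(\<lambda>N. \<Sum>j\<le>N. bernstein_weight g N j * (real j / real N) ^ n) \<longlonglongrightarrow> g n"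
proof -
  have w: "0 \<le> bernstein_weight g N j" for N j by (simp add: bernstein_weight_def cm)
  have total: "(\<Sum>j\<le>N. bernstein_weight g N j) = g 0" for N
    using bernstein_weight_moment[of 0 N g] by simp
  have "\<bar>(\<Sum>j\<le>N. bernstein_weight g N j * (real j / real N) ^ n) - g n\<bar> \<le> g 0 * ((real n)\<^sup>2 / real N)"
    if N: "n \<le> N" "0 < N" for N
  proof -
    have "\<bar>(\<Sum>j\<le>N. bernstein_weight g N j * (real j / real N) ^ n) - g n\<bar>
        = \<bar>\<Sum>j\<le>N. bernstein_weight g N j *
            ((real j / real N) ^ n - real (j choose n) / real (N choose n))\<bar>"
      by (simp add: bernstein_weight_moment[OF N(1), symmetric] right_diff_distrib sum_subtractf
          del: times_divide_eq_right)
    also have "\<dots> \<le> (\<Sum>j\<le>N. bernstein_weight g N j * ((real n)\<^sup>2 / real N))"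
      using choose_ratio_power_dist N w
      by (intro order_trans[OF sum_abs] sum_mono)
        (auto simp: abs_mult abs_minus_commute simp del: times_divide_eq_right intro!: mult_left_mono)
    finally show ?thesis by (simp add: sum_distrib_right[symmetric] total del: times_divide_eq_right)
  qed
  then have "\<forall>\<^sub>F N in sequentially.
      norm ((\<Sum>j\<le>N. bernstein_weight g N j * (real j / real N) ^ n) - g n) \<le> g 0 * ((real n)\<^sup>2 / real N)"
    by (intro eventually_sequentiallyI[of "Suc n"]) simp
  moreover have "(\<lambda>N. g 0 * ((real n)\<^sup>2 / real N)) \<longlonglongrightarrow> 0"
    by (intro tendsto_mult_right_zero lim_const_over_n)
  ultimately show ?thesis
    by (rule LIM_zero_cancel[OF Lim_null_comparison])
qed

text \<open>For \<open>s > 0\<close>, the moments are those of the symmetric distribution on \<open>[-s, s]\<close> whose image under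
  \<open>x \<mapsto> (x / s)\<^sup>2\<close> has the moments \<open>g\<close>. Passing to square roots of the variable here spares taking
  square roots of operators later. The proof approximates by point masses at
  \<open>s * sqrt (j / N)\<close> and \<open>- s * sqrt (j / N)\<close>.\<close>

lemma symmetric_moment_functional_nonneg:
  assumes cm: "\<And>n k. 0 \<le> (nabla ^^ n) g k" and s: "0 \<le> s"
    and nonneg: "\<And>x. \<bar>x\<bar> \<le> s \<Longrightarrow> 0 \<le> poly f x"
  shows "0 \<le> moment_functional (\<lambda>n. if even n then s ^ n * g (n div 2) else 0) f"
proof -
  define h where "h n = (if even n then s ^ n * g (n div 2) else 0)" for n
  define m where "m N n = (\<Sum>j\<le>N. bernstein_weight g N j *
      (((s * sqrt (real j / real N)) ^ n + (- (s * sqrt (real j / real N))) ^ n) / 2))" for N n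
  have m: "(\<lambda>N. m N n) \<longlonglongrightarrow> h n" for n
  proof (cases "even n")
    case True
    then obtain l where l: "n = 2 * l" by blast
    have "((s * sqrt t) ^ n + (- (s * sqrt t)) ^ n) / 2 = s ^ n * t ^ l" if "0 \<le> t" for t
      using that by (simp add: l power_mult_distrib power_mult[of "sqrt t"])
    then have "m N n = s ^ n * (\<Sum>j\<le>N. bernstein_weight g N j * (real j / real N) ^ l)" for N
      unfolding m_def sum_distrib_left by (intro sum.cong refl) simp
    then show ?thesis
      using tendsto_mult_left[OF hausdorff_moment_approximation[OF cm, of l], of "s ^ n"] by (simp add: h_def l)
  next
    case False
    then show ?thesis by (simp add: m_def h_def)
  qed
  have "(\<Sum>i\<le>degree f. coeff f i * m N i) = (\<Sum>j\<le>N. bernstein_weight g N j *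
      ((poly f (s * sqrt (real j / real N)) + poly f (- (s * sqrt (real j / real N)))) / 2))" for N
    unfolding m_def poly_altdef sum.distrib[symmetric] sum_divide_distrib sum_distrib_left
    by (subst sum.swap) (intro sum.cong refl, simp add: algebra_simps add_divide_distrib)
  moreover have "\<bar>s * sqrt (real j / real N)\<bar> \<le> s" if "j \<le> N" for j N
    using s that by (cases "N = 0") (auto simp: abs_mult intro!: mult_left_le)
  ultimately have "0 \<le> (\<Sum>i\<le>degree f. coeff f i * m N i)" for N
    by (auto intro!: sum_nonneg mult_nonneg_nonneg add_nonneg_nonneg nonneg simp: bernstein_weight_def cm)
  moreover have "(\<lambda>N. \<Sum>i\<le>degree f. coeff f i * m N i) \<longlonglongrightarrow> moment_functional h f"
    unfolding moment_functional_def by (intro tendsto_intros m)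
  ultimately have "0 \<le> moment_functional h f" by (intro LIMSEQ_le_const) auto
  then show ?thesis by (simp add: h_def[abs_def])
qed

section \<open>The Jacobi matrix of a positive functional\<close>

text \<open>A positive functional on polynomials is a semi-inner product \<open>\<Lambda> (p * q)\<close> for which multiplication by
  \<open>X\<close> is symmetric; the last assumption makes it bounded. Null vectors are possible, and they occur
  when \<open>\<Lambda>\<close> comes from a measure with finite support.\<close>

locale positive_functional =
  fixes \<Lambda> :: "real poly \<Rightarrow> real" and s :: real
  assumes add: "\<Lambda> (p + q) = \<Lambda> p + \<Lambda> q"
    and scale: "\<Lambda> (Polynomial.smult c p) = c * \<Lambda> p"
    and square_nonneg: "0 \<le> \<Lambda> (p * p)"
    and one: "\<Lambda> 1 = 1"
    and X_bound: "\<Lambda> (monom 1 1 * p * (monom 1 1 * p)) \<le> s\<^sup>2 * \<Lambda> (p * p)"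
begin

abbreviation X :: "real poly" where "X \<equiv> monom 1 1"

lemma diff: "\<Lambda> (p - q) = \<Lambda> p - \<Lambda> q"
  using add[of p "- q"] scale[of "-1" q] by simp

lemma zero: "\<Lambda> 0 = 0"
  using scale[of 0 0] by simp

lemma cauchy_schwarz: "(\<Lambda> (p * q))\<^sup>2 \<le> \<Lambda> (p * p) * \<Lambda> (q * q)"
proof -
  have quad: "0 \<le> \<Lambda> (p * p) + t * (2 * \<Lambda> (p * q)) + t\<^sup>2 * \<Lambda> (q * q)" for t
  proof -
    have "(p + Polynomial.smult t q) * (p + Polynomial.smult t q)
        = p * p + Polynomial.smult t (p * q) + Polynomial.smult t (p * q)
          + Polynomial.smult (t\<^sup>2) (q * q)"
      by (simp add: algebra_simps power2_eq_square smult_add_right)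
    then have "\<Lambda> ((p + Polynomial.smult t q) * (p + Polynomial.smult t q))
        = \<Lambda> (p * p) + t * (2 * \<Lambda> (p * q)) + t\<^sup>2 * \<Lambda> (q * q)"
      by (simp only: add scale)
    then show ?thesis
      using square_nonneg[of "p + Polynomial.smult t q"] by simp
  qed
  show ?thesis
  proof (cases "\<Lambda> (q * q) = 0")
    case True
    have "\<Lambda> (p * q) = 0"
    proof (rule ccontr)
      assume "\<Lambda> (p * q) \<noteq> 0"
      then show False
        \<comment> \<open>This \<open>t\<close> makes the quadratic function, which is now affine, equal to \<open>-1\<close>.\<close>
        using quad[of "- (\<Lambda> (p * p) + 1) / (2 * \<Lambda> (p * q))"] True by simp
    qed
    then show ?thesis using True by simp
  next
    case False
    then have pos: "0 < \<Lambda> (q * q)" using square_nonneg[of q] by linarith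
    then have "\<Lambda> (p * p) + (- (\<Lambda> (p * q) / \<Lambda> (q * q))) * (2 * \<Lambda> (p * q))
        + (- (\<Lambda> (p * q) / \<Lambda> (q * q)))\<^sup>2 * \<Lambda> (q * q)
        = (\<Lambda> (p * p) * \<Lambda> (q * q) - (\<Lambda> (p * q))\<^sup>2) / \<Lambda> (q * q)"
      by (simp add: field_simps power2_eq_square)
    then have "0 \<le> (\<Lambda> (p * p) * \<Lambda> (q * q) - (\<Lambda> (p * q))\<^sup>2) / \<Lambda> (q * q)"
      using quad by metis
    then show ?thesis using pos by (simp add: zero_le_divide_iff)
  qed
qed

text \<open>A state \<open>(b, p, q)\<close> consists of two consecutive orthonormal polynomials and the coefficient
  \<open>b\<close> that links them. If \<open>r\<close> is a null vector, \<open>inverse 0 = 0\<close> makes the new polynomial, and as a consequence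
  all later polynomials and coefficients, vanish; the Jacobi matrix is then continued by zeros.\<close>

fun lanczos :: "nat \<Rightarrow> real \<times> real poly \<times> real poly" where
  "lanczos 0 = (0, 0, 1)"
| "lanczos (Suc n) = (case lanczos n of (b, p, q) \<Rightarrow>
     let r = X * q - Polynomial.smult (\<Lambda> (X * q * q)) q - Polynomial.smult b p;
         b' = sqrt (\<Lambda> (r * r))
     in (b', q, Polynomial.smult (inverse b') r))"

text \<open>The index of the orthonormal polynomials \<open>R\<close> is shifted by one, so that \<open>R 0 = 0\<close> and \<open>R 1 = 1\<close>.
  Then \<open>b 0 = 0\<close>, and the three-term recurrence holds for all indices, at 0 because \<open>0 - 1 = 0\<close> for
  natural numbers.\<close>

definition R :: "nat \<Rightarrow> real poly" where "R n = fst (snd (lanczos n))"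
definition a :: "nat \<Rightarrow> real" where "a n = \<Lambda> (X * R n * R n)"
definition b :: "nat \<Rightarrow> real" where "b n = fst (lanczos n)"

definition Q :: "nat \<Rightarrow> real poly" where
  "Q n = X * R n - Polynomial.smult (a n) (R n) - Polynomial.smult (b (n - 1)) (R (n - 1))"

lemma R_0 [simp]: "R 0 = 0" and R_1 [simp]: "R (Suc 0) = 1" and b_0 [simp]: "b 0 = 0"
  and a_0 [simp]: "a 0 = 0"
  by (simp_all add: R_def b_def a_def Let_def zero)

lemma Q_0 [simp]: "Q 0 = 0"
  by (simp add: Q_def)

lemma lanczos_eq: "lanczos n = (b n, R n, R (Suc n))"
  by (cases "lanczos n") (simp add: R_def b_def Let_def)

lemma step: "X * R (Suc m) - Polynomial.smult (\<Lambda> (X * R (Suc m) * R (Suc m))) (R (Suc m))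
    - Polynomial.smult (b m) (R m) = Q (Suc m)"
  by (simp add: Q_def a_def)

lemma b_eq: "b n = sqrt (\<Lambda> (Q n * Q n))"
proof (cases n)
  case 0
  then show ?thesis by (simp add: zero)
next
  case (Suc m)
  have "b (Suc m) = fst (lanczos (Suc m))" by (simp only: b_def)
  then show ?thesis
    unfolding Suc by (simp add: lanczos_eq[of m] step[simplified] Let_def)
qed

lemma R_Suc: "n \<ge> 1 \<Longrightarrow> R (Suc n) = Polynomial.smult (inverse (b n)) (Q n)"
proof (cases n)
  case (Suc m)
  have "R (Suc (Suc m)) = snd (snd (lanczos (Suc m)))" by (simp only: lanczos_eq snd_conv)
  then show ?thesis
    unfolding Suc by (simp add: lanczos_eq[of m] step[simplified] Let_def b_eq[of "Suc m"])
qed simp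

lemma b_nonneg: "0 \<le> b n"
  by (simp add: b_eq square_nonneg)

text \<open>If \<open>b n = 0\<close>, then \<open>Q n\<close> need not be 0, but it is a null vector and so orthogonal to everything.
  Tested against an arbitrary polynomial \<open>v\<close>, the three-term recurrence therefore holds without
  exception.\<close>

lemma Q_weak: "\<Lambda> (Q n * v) = b n * \<Lambda> (R (Suc n) * v)"
proof (cases "b n = 0")
  case True
  then have "\<Lambda> (Q n * Q n) = 0" by (simp add: b_eq)
  then have "\<Lambda> (Q n * v) = 0" using cauchy_schwarz[of "Q n" v] by simp
  then show ?thesis using True by simp
next
  case False
  then have "n \<ge> 1" by (cases n) auto
  then show ?thesis using False by (simp add: R_Suc scale)
qed

lemma recurrence:
  "\<Lambda> (X * R n * v) = b n * \<Lambda> (R (Suc n) * v) + a n * \<Lambda> (R n * v) + b (n - 1) * \<Lambda> (R (n - 1) * v)"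
  using Q_weak[of n v] unfolding Q_def by (simp add: left_diff_distrib diff scale)

lemma R_norm: "\<Lambda> (R (Suc n) * R (Suc n)) = (if n = 0 \<or> b n \<noteq> 0 then 1 else 0)"
proof (cases "n = 0")
  case True
  then show ?thesis by (simp add: one)
next
  case n: False
  show ?thesis
  proof (cases "b n = 0")
    case True
    then show ?thesis using n by (simp add: R_Suc zero)
  next
    case False
    have "\<Lambda> (Q n * Q n) = b n * b n" by (simp add: b_eq square_nonneg)
    then show ?thesis using n False by (simp add: R_Suc scale field_simps)
  qed
qed

lemma R_norm_le: "\<Lambda> (R n * R n) \<le> 1"
  by (cases n) (simp_all add: R_norm zero)

lemma degenerate:
  assumes "\<Lambda> (R n * R n) \<noteq> 1"
  shows "R n = 0" "a n = 0" "b n = 0" "b (n - 1) = 0"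
proof -
  show R: "R n = 0"
    using assms by (cases n) (auto simp: R_norm R_Suc split: if_splits)
  then show "a n = 0" by (simp add: a_def zero)
  show b': "b (n - 1) = 0"
    using assms by (cases n) (auto simp: R_norm split: if_splits)
  have "Q n = 0" using R b' by (simp add: Q_def)
  then show "b n = 0" by (simp add: b_eq zero)
qed

text \<open>The usual argument for three-term recurrences: \<open>R (n + 1)\<close> is a multiple of \<open>X * R n\<close> minus its
  components along \<open>R n\<close> and \<open>R (n - 1)\<close>, and by symmetry \<open>X * R n\<close> is orthogonal to \<open>R j\<close> if
  \<open>j < n - 1\<close>.\<close>

lemma orthogonal_le: "i \<le> n \<Longrightarrow> j \<le> n \<Longrightarrow> i \<noteq> j \<Longrightarrow> \<Lambda> (R i * R j) = 0"
proof (induction n arbitrary: i j)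
  case (Suc n)
  have new: "\<Lambda> (R (Suc n) * R j) = 0" if j: "j \<le> n" for j
  proof (cases "b n = 0")
    case True
    then show ?thesis
      using j by (cases "n = 0") (simp_all add: R_Suc zero)
  next
    case False
    then have n: "\<Lambda> (R n * R n) = 1" using degenerate by blast
    have "b n * \<Lambda> (R (Suc n) * R j)
        = \<Lambda> (X * R n * R j) - a n * \<Lambda> (R n * R j) - b (n - 1) * \<Lambda> (R (n - 1) * R j)"
      using recurrence[of n "R j"] by simp
    also have "\<dots> = 0"
    proof (cases "j = n")
      case True
      have "b (n - 1) * \<Lambda> (R (n - 1) * R n) = 0"
        using Suc.IH[of "n - 1" n] by (cases n) auto
      then show ?thesis using True n by (simp add: a_def)
    next
      case False
      then have j: "j < n" using \<open>j \<le> n\<close> by simp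
      have "\<Lambda> (X * R n * R j) = \<Lambda> (X * R j * R n)" by (simp add: mult_ac)
      also have "\<dots> = b j * \<Lambda> (R (Suc j) * R n)"
        using recurrence[of j "R n"] Suc.IH[of j n] Suc.IH[of "j - 1" n] j by simp
      finally have 1: "\<Lambda> (X * R n * R j) = b j * \<Lambda> (R (Suc j) * R n)" .
      show ?thesis
      proof (cases "Suc j = n")
        case True
        have "b j * \<Lambda> (R n * R n) = b j * \<Lambda> (R j * R j)"
          using degenerate[of j] n by (cases "\<Lambda> (R j * R j) = 1") auto
        then show ?thesis using 1 True Suc.IH[of n j] j by auto
      next
        case False
        then show ?thesis using 1 Suc.IH[of "Suc j" n] Suc.IH[of n j] Suc.IH[of "n - 1" j] j
          by auto
      qed
    qed
    finally show ?thesis using \<open>b n \<noteq> 0\<close> by simp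
  qed
  consider "i \<le> n" "j \<le> n" | "i = Suc n" "j \<le> n" | "j = Suc n" "i \<le> n"
    using Suc.prems by linarith
  then show ?case
    using Suc.IH Suc.prems(3) new by cases (auto simp: mult.commute)
qed simp

lemma orthogonal: "i \<noteq> j \<Longrightarrow> \<Lambda> (R i * R j) = 0"
  using orthogonal_le[of i "max i j" j] by simp

text \<open>The coefficients \<open>a n\<close> and \<open>b n\<close> are matrix entries of multiplication by \<open>X\<close>, whose norm is at most
  \<open>\<bar>s\<bar>\<close>.\<close>

lemma X_R_norm: "\<Lambda> (X * R n * (X * R n)) \<le> s\<^sup>2"
  using X_bound[of "R n"] mult_left_mono[OF R_norm_le[of n], of "s\<^sup>2"] by simp

lemma X_R_inner: "(\<Lambda> (X * R n * R m))\<^sup>2 \<le> s\<^sup>2"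
proof -
  have "(\<Lambda> (X * R n * R m))\<^sup>2 \<le> \<Lambda> (X * R n * (X * R n)) * \<Lambda> (R m * R m)"
    by (rule cauchy_schwarz)
  also have "\<dots> \<le> s\<^sup>2 * 1"
    by (intro mult_mono X_R_norm R_norm_le square_nonneg) auto
  finally show ?thesis by simp
qed

lemma a_bound: "\<bar>a n\<bar> \<le> \<bar>s\<bar>"
  using X_R_inner[of n n] by (simp add: a_def abs_le_square_iff)

lemma b_bound: "\<bar>b n\<bar> \<le> \<bar>s\<bar>"
proof (cases "b n = 0")
  case False
  then have "n \<noteq> 0" by (cases n) auto
  then have "\<Lambda> (X * R n * R (Suc n)) = b n"
    using recurrence[of n "R (Suc n)"] False by (simp add: orthogonal R_norm)
  then show ?thesis using X_R_inner[of n "Suc n"] by (simp add: abs_le_square_iff)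
qed simp

text \<open>The coordinates of \<open>X ^ n\<close> with respect to the \<open>R k\<close>, that is, of the \<open>n\<close>-th vector in the orbit of
  the first basis vector under the Jacobi matrix.\<close>

definition c :: "nat \<Rightarrow> nat \<Rightarrow> real" where "c n k = \<Lambda> (X ^ n * R k)"

lemma c_0 [simp]: "c n 0 = 0"
  by (simp add: c_def zero)

lemma c_Suc: "c (Suc n) k = b k * c n (Suc k) + a k * c n k + b (k - 1) * c n (k - 1)"
  using recurrence[of k "X ^ n"] by (simp add: c_def mult_ac)

text \<open>Modulo null vectors, \<open>X ^ n\<close> is in the span of \<open>R 0, \<dots>, R (n + 1)\<close>. The two claims are proved
  together: that the coordinates vanish beyond \<open>n + 1\<close> makes the index shifts in the induction
  step possible.\<close>

lemma expansion: 
  "(\<forall>v. \<Lambda> (X ^ n * v) = (\<Sum>k\<le>Suc n. c n k * \<Lambda> (R k * v))) \<and> (\<forall>k>Suc n. c n k = 0)"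
proof (induction n)
  case 0
  have "c 0 k = 0" if "k > Suc 0" for k
    using orthogonal[of k "Suc 0"] that by (simp add: c_def)
  moreover have "c 0 (Suc 0) = 1" by (simp add: c_def one)
  ultimately show ?case by simp
next
  case (Suc n)
  have tail: "c n k = 0" if "k > Suc n" for k using Suc that by blast
  have "\<Lambda> (X ^ Suc n * v) = (\<Sum>k\<le>Suc (Suc n). c (Suc n) k * \<Lambda> (R k * v))" for v
  proof -
    define r where "r k = \<Lambda> (R k * v)" for k
    have r0: "r 0 = 0" by (simp add: r_def zero)
    have "\<Lambda> (X ^ Suc n * v) = \<Lambda> (X ^ n * (X * v))" by (simp add: mult_ac)
    also have "\<dots> = (\<Sum>k\<le>Suc n. c n k * \<Lambda> (R k * (X * v)))" using Suc by blast
    also have "\<dots> = (\<Sum>k\<le>Suc n. c n k * (b k * r (Suc k) + a k * r k + b (k - 1) * r (k - 1)))"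
    proof (intro sum.cong refl)
      fix k
      have "R k * (X * v) = X * R k * v" by (simp only: mult_ac)
      then show "c n k * \<Lambda> (R k * (X * v)) = c n k * (b k * r (Suc k) + a k * r k + b (k - 1) * r (k - 1))"
        by (simp only: recurrence r_def)
    qed
    also have "\<dots> = (\<Sum>k\<le>Suc n. b k * c n k * r (Suc k)) + (\<Sum>k\<le>Suc n. a k * c n k * r k)
        + (\<Sum>k\<le>Suc n. b (k - 1) * c n k * r (k - 1))"
      unfolding sum.distrib[symmetric] by (intro sum.cong refl) (simp add: algebra_simps)
    also have "(\<Sum>k\<le>Suc n. b k * c n k * r (Suc k)) = (\<Sum>k\<le>Suc (Suc n). b (k - 1) * c n (k - 1) * r k)"
      by (subst sum.atMost_Suc_shift[of _ "Suc n"]) (simp add: r0)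
    also have "(\<Sum>k\<le>Suc n. b (k - 1) * c n k * r (k - 1)) = (\<Sum>k\<le>Suc (Suc n). b k * c n (Suc k) * r k)"
      by (subst sum.atMost_Suc_shift) (simp add: tail)
    also have "(\<Sum>k\<le>Suc n. a k * c n k * r k) = (\<Sum>k\<le>Suc (Suc n). a k * c n k * r k)"
      by (simp add: tail)
    finally show ?thesis
      unfolding c_Suc r_def[symmetric] sum.distrib[symmetric]
      by (simp only: distrib_right add.commute add.left_commute)
  qed
  moreover have "c (Suc n) k = 0" if "k > Suc (Suc n)" for k
    using that by (simp add: c_Suc tail)
  ultimately show ?case by blast
qed

lemma c_support: "k > Suc n \<Longrightarrow> c n k = 0"
  using expansion by blast

lemma parseval: "(\<Sum>k\<le>Suc n. (c n k)\<^sup>2) = \<Lambda> (X ^ (2 * n))"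
proof -
  have "\<Lambda> (X ^ (2 * n)) = \<Lambda> (X ^ n * X ^ n)" by (simp add: mult_2 power_add)
  also have "\<dots> = (\<Sum>k\<le>Suc n. c n k * \<Lambda> (R k * X ^ n))" using expansion by blast
  also have "\<dots> = (\<Sum>k\<le>Suc n. (c n k)\<^sup>2)"
    by (simp only: c_def power2_eq_square mult_ac)
  finally show ?thesis by simp
qed

end

section \<open>Bounded operators and isometries on the sequence space\<close>

abbreviation sq_summable :: "(nat \<Rightarrow> complex) \<Rightarrow> bool" where
  "sq_summable f \<equiv> summable (\<lambda>n. (cmod (f n))\<^sup>2)"

lemma carrier_ell2: "f \<in> carrier ell2 \<longleftrightarrow> sq_summable f"
  by (simp add: ell2_def)

lemma add_ell2: "f \<oplus>\<^bsub>ell2\<^esub> g = (\<lambda>n. f n + g n)"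
  and smult_ell2: "z \<odot>\<^bsub>ell2\<^esub> f = (\<lambda>n. z * f n)"
  and cinner_ell2: "cinner ell2 f g = (\<Sum>n. f n * cnj (g n))"
  by (simp_all add: ell2_def)

lemma hnorm_triangle_ell2:
  assumes "f \<in> carrier ell2" "g \<in> carrier ell2"
  shows "hnorm ell2 (\<lambda>n. f n + g n) \<le> hnorm ell2 f + hnorm ell2 g"
proof -
  interpret E: Metric_space "carrier ell2" "hdist ell2" by (rule Metric_space_ell2)
  have mem: "(\<lambda>_. 0) \<in> carrier ell2" "(\<lambda>n. - g n) \<in> carrier ell2"
    using assms by (auto simp: carrier_ell2)
  have "hdist ell2 f (\<lambda>n. - g n) \<le> hdist ell2 f (\<lambda>_. 0) + hdist ell2 (\<lambda>_. 0) (\<lambda>n. - g n)"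
    using assms mem by (intro E.triangle) auto
  then show ?thesis
    using assms mem by (simp add: hdist_def ell2_minus)
qed

lemma bounded_operator_add:
  assumes "bounded_operator ell2 S" "bounded_operator ell2 T"
  shows "bounded_operator ell2 (\<lambda>f n. S f n + T f n)"
proof -
  obtain B C where B: "\<And>f. f \<in> carrier ell2 \<Longrightarrow> hnorm ell2 (S f) \<le> B * hnorm ell2 f"
    and C: "\<And>f. f \<in> carrier ell2 \<Longrightarrow> hnorm ell2 (T f) \<le> C * hnorm ell2 f"
    using assms unfolding bounded_operator_def by blast
  have mem: "S f \<in> carrier ell2" "T f \<in> carrier ell2" if "f \<in> carrier ell2" for f
    using assms that by (auto simp: bounded_operator_def linear_map_def)
  have "linear_map ell2 ell2 (\<lambda>f n. S f n + T f n)"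
    using assms mem
    by (auto simp: bounded_operator_def linear_map_def add_ell2 smult_ell2 algebra_simps
        carrier_ell2 ell2_summable_add)
  moreover have "hnorm ell2 (\<lambda>n. S f n + T f n) \<le> (B + C) * hnorm ell2 f" if "f \<in> carrier ell2" for f
    using hnorm_triangle_ell2[OF mem[OF that]] B[OF that] C[OF that] by (simp add: distrib_right)
  ultimately show ?thesis unfolding bounded_operator_def by blast
qed

lemma adjoint_operator_add:
  assumes "bounded_operator ell2 S" "bounded_operator ell2 T"
    and "adjoint_operator ell2 S A" "adjoint_operator ell2 T B"
  shows "adjoint_operator ell2 (\<lambda>f n. S f n + T f n) (\<lambda>f n. A f n + B f n)"
  unfolding adjoint_operator_def
proof (intro conjI ballI)
  show "bounded_operator ell2 (\<lambda>f n. A f n + B f n)"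
    using assms by (intro bounded_operator_add) (simp_all add: adjoint_operator_def)
  fix f g assume fg: "f \<in> carrier ell2" "g \<in> carrier ell2"
  then have "S f \<in> carrier ell2" "T f \<in> carrier ell2" "A g \<in> carrier ell2" "B g \<in> carrier ell2"
    using assms by (auto simp: bounded_operator_def adjoint_operator_def linear_map_def)
  then have sm: "summable (\<lambda>n. S f n * cnj (g n))" "summable (\<lambda>n. T f n * cnj (g n))"
    "summable (\<lambda>n. f n * cnj (A g n))" "summable (\<lambda>n. f n * cnj (B g n))"
    using fg by (auto simp: carrier_ell2 intro: ell2_summable_cinner)
  have "cinner ell2 (\<lambda>n. S f n + T f n) g = cinner ell2 (S f) g + cinner ell2 (T f) g"
    using sm by (simp add: cinner_ell2 distrib_right suminf_add)
  also have "\<dots> = cinner ell2 f (A g) + cinner ell2 f (B g)"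
    using assms fg by (simp add: adjoint_operator_def)
  also have "\<dots> = cinner ell2 f (\<lambda>n. A g n + B g n)"
    using sm by (simp add: cinner_ell2 distrib_left suminf_add)
  finally show "cinner ell2 (\<lambda>n. S f n + T f n) g = cinner ell2 f (\<lambda>n. A g n + B g n)" .
qed

section \<open>The bilateral shift tensored with a Jacobi matrix\<close>

text \<open>A bijective enumeration of \<open>int \<times> int\<close>: \<open>f (code (m, k))\<close> is the entry with index \<open>k\<close> in the fibre
  over \<open>m\<close>.\<close>

definition code :: "int \<times> int \<Rightarrow> nat" where
  "code = (\<lambda>(m, k). prod_encode (int_encode m, int_encode k))"

definition decode :: "nat \<Rightarrow> int \<times> int" where
  "decode n = (int_decode (fst (prod_decode n)), int_decode (snd (prod_decode n)))"

lemma decode_code [simp]: "decode (code z) = z"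
  by (simp add: code_def decode_def split_beta)

lemma code_decode [simp]: "code (decode n) = n"
  by (simp add: code_def decode_def)

lemma bij_code: "bij code"
  by (rule bij_betw_byWitness[where f' = decode]) auto

definition translation :: "int \<times> int \<Rightarrow> nat \<Rightarrow> nat" where
  "translation v n = code (decode n + v)"

lemma bij_translation: "bij (translation v)"
  by (rule bij_betw_byWitness[where f' = "translation (- v)"]) (auto simp: translation_def)

definition weighted_translation ::
    "(int \<times> int \<Rightarrow> real) \<Rightarrow> int \<times> int \<Rightarrow> (nat \<Rightarrow> complex) \<Rightarrow> nat \<Rightarrow> complex" where
  "weighted_translation w v f n = of_real (w (decode n)) * f (translation v n)"

lemma weighted_translation_code:
  "weighted_translation w v f (code z) = of_real (w z) * f (code (z + v))"
  by (simp add: weighted_translation_def translation_def)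

lemma suminf_reindex_bij:
  fixes F :: "nat \<Rightarrow> 'a :: banach"
  assumes "bij \<sigma>" "summable (\<lambda>n. norm (F n))"
  shows "summable (\<lambda>n. F (\<sigma> n))" "(\<Sum>n. F (\<sigma> n)) = (\<Sum>n. F n)"
proof -
  have "(F has_sum (\<Sum>n. F n)) UNIV" 
    using assms(2) summable_norm_cancel[OF assms(2)]
    by (intro norm_summable_imp_has_sum summable_sums)
  then have "((\<lambda>n. F (\<sigma> n)) has_sum (\<Sum>n. F n)) UNIV"
    using has_sum_reindex_bij_betw[OF assms(1), of F] by blast
  then have "(\<lambda>n. F (\<sigma> n)) sums (\<Sum>n. F n)" by (rule has_sum_imp_sums)
  then show "summable (\<lambda>n. F (\<sigma> n))" "(\<Sum>n. F (\<sigma> n)) = (\<Sum>n. F n)"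
    by (auto simp: sums_iff)
qed

lemma bounded_operator_weighted_translation:
  assumes w: "\<And>z. \<bar>w z\<bar> \<le> B"
  shows "bounded_operator ell2 (weighted_translation w v)"
proof -
  have B: "0 \<le> B" using w[of 0] by linarith
  have bnd: "weighted_translation w v f \<in> carrier ell2 \<and>
      hnorm ell2 (weighted_translation w v f) \<le> B * hnorm ell2 f" if "f \<in> carrier ell2" for f
  proof -
    have sf: "sq_summable f" using that by (simp add: carrier_ell2)
    have st: "sq_summable (\<lambda>n. f (translation v n))"
      and eq: "(\<Sum>n. (cmod (f (translation v n)))\<^sup>2) = (\<Sum>n. (cmod (f n))\<^sup>2)"
      using suminf_reindex_bij[OF bij_translation, of "\<lambda>n. (cmod (f n))\<^sup>2" v] sf by simp_all
    have le: "(cmod (weighted_translation w v f n))\<^sup>2 \<le> B\<^sup>2 * (cmod (f (translation v n)))\<^sup>2" for n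
      using w[of "decode n"] B
      by (auto simp: weighted_translation_def norm_mult power_mult_distrib power2_le_iff_abs_le
          intro!: mult_right_mono)
    have sw: "sq_summable (weighted_translation w v f)"
      by (rule summable_comparison_test'[OF summable_mult[OF st], where N = 0]) (use le in auto)
    have "(\<Sum>n. (cmod (weighted_translation w v f n))\<^sup>2) \<le> B\<^sup>2 * (\<Sum>n. (cmod (f n))\<^sup>2)"
      unfolding eq[symmetric] suminf_mult[OF st, symmetric]
      by (intro suminf_le le sw summable_mult st)
    then have "hnorm ell2 (weighted_translation w v f) \<le> sqrt (B\<^sup>2 * (\<Sum>n. (cmod (f n))\<^sup>2))"
      using sw by (simp add: ell2_hnorm carrier_ell2)
    then show ?thesis
      using B sw that by (simp add: ell2_hnorm carrier_ell2 real_sqrt_mult)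
  qed
  then show ?thesis
    unfolding bounded_operator_def linear_map_def
    by (auto simp: add_ell2 smult_ell2 weighted_translation_def fun_eq_iff algebra_simps)
qed

lemma adjoint_weighted_translation:
  assumes w: "\<And>z. \<bar>w z\<bar> \<le> B"
  shows "adjoint_operator ell2 (weighted_translation w v) (weighted_translation (\<lambda>z. w (z - v)) (- v))"
  unfolding adjoint_operator_def
proof (intro conjI ballI)
  show "bounded_operator ell2 (weighted_translation (\<lambda>z. w (z - v)) (- v))"
    by (rule bounded_operator_weighted_translation) (rule w)
  fix f g assume fg: "f \<in> carrier ell2" "g \<in> carrier ell2"
  define F where "F n = f n * cnj (weighted_translation (\<lambda>z. w (z - v)) (- v) g n)" for n
  have "weighted_translation (\<lambda>z. w (z - v)) (- v) g \<in> carrier ell2"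
    using bounded_operator_weighted_translation[of "\<lambda>z. w (z - v)" B "- v"] w fg
    by (auto simp: bounded_operator_def linear_map_def)
  then have "summable (\<lambda>n. norm (F n))"
    using fg ell2_summable_cinner[of "\<lambda>n. of_real (cmod (f n))"
        "\<lambda>n. of_real (cmod (weighted_translation (\<lambda>z. w (z - v)) (- v) g n))"]
    by (simp add: F_def carrier_ell2 norm_mult summable_of_real_iff flip: of_real_mult)
  then have "(\<Sum>n. F (translation v n)) = (\<Sum>n. F n)"
    by (rule suminf_reindex_bij(2)[OF bij_translation])
  also have "(\<lambda>n. F (translation v n)) = (\<lambda>n. weighted_translation w v f n * cnj (g n))"
    by (simp add: F_def weighted_translation_def translation_def fun_eq_iff)
  finally show "cinner ell2 (weighted_translation w v f) g
      = cinner ell2 f (weighted_translation (\<lambda>z. w (z - v)) (- v) g)"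
    by (simp add: cinner_ell2 F_def)
qed

text \<open>In coordinates, the value at \<open>(m, k)\<close> is
  \<open>b (k - 1) * f (m - 1, k - 1) + a k * f (m - 1, k) + b k * f (m - 1, k + 1)\<close>: the symmetric tridiagonal
  matrix with diagonal \<open>a\<close> and off-diagonal \<open>b\<close> acts on the fibre over \<open>m - 1\<close>, and the result is moved to
  the fibre over \<open>m\<close>.\<close>

definition jacobi_shift :: "(int \<Rightarrow> real) \<Rightarrow> (int \<Rightarrow> real) \<Rightarrow> (nat \<Rightarrow> complex) \<Rightarrow> nat \<Rightarrow> complex" where
  "jacobi_shift a b f = (\<lambda>n.
     weighted_translation (\<lambda>(m, k). b (k - 1)) (-1, -1) f n
     + (weighted_translation (\<lambda>(m, k). a k) (-1, 0) f n
     + weighted_translation (\<lambda>(m, k). b k) (-1, 1) f n))"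

text \<open>The adjoint applies the same matrix and moves to the fibre over \<open>m - 1\<close>, because the matrix is
  symmetric. So both products apply the square of the matrix in each fibre.\<close>

lemma normal_jacobi_shift:
  assumes a: "\<And>k. \<bar>a k\<bar> \<le> B" and b: "\<And>k. \<bar>b k\<bar> \<le> B"
  shows "normal_operator ell2 (jacobi_shift a b)"
proof -
  note bnd = bounded_operator_weighted_translation[where B = B]
  define A where "A f = (\<lambda>n.
     weighted_translation (\<lambda>z. case z - (-1, -1) of (m, k) \<Rightarrow> b (k - 1)) (- (-1, -1)) f n
     + (weighted_translation (\<lambda>z. case z - (-1, 0) of (m, k) \<Rightarrow> a k) (- (-1, 0)) f n
     + weighted_translation (\<lambda>z. case z - (-1, 1) of (m, k) \<Rightarrow> b k) (- (-1, 1)) f n))" for f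
  have N: "bounded_operator ell2 (jacobi_shift a b)"
    unfolding jacobi_shift_def[abs_def] by (intro bounded_operator_add bnd) (auto simp: a b)
  moreover have "adjoint_operator ell2 (jacobi_shift a b) A"
    unfolding jacobi_shift_def[abs_def] A_def[abs_def]
    by (intro adjoint_operator_add bounded_operator_add bnd adjoint_weighted_translation[where B = B])
      (auto simp: a b)
  moreover have "jacobi_shift a b (A f) = A (jacobi_shift a b f)" for f
  proof
    fix n
    obtain m k where n: "n = code (m, k)" by (metis code_decode surj_pair)
    show "jacobi_shift a b (A f) n = A (jacobi_shift a b f) n"
      by (simp add: n jacobi_shift_def A_def weighted_translation_code algebra_simps)
  qed
  ultimately show ?thesis unfolding normal_operator_def by blast
qed

lemma bounded_operator_weighted_shift:
  assumes B: "\<And>n. \<bar>\<alpha> n\<bar> \<le> B"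
  shows "bounded_operator ell2 (weighted_shift \<alpha>)"
proof -
  have B0: "0 \<le> B" using B[of 0] by linarith
  have bnd: "weighted_shift \<alpha> f \<in> carrier ell2 \<and> hnorm ell2 (weighted_shift \<alpha> f) \<le> B * hnorm ell2 f"
    if f: "f \<in> carrier ell2" for f
  proof -
    have sf: "sq_summable f" using f by (simp add: carrier_ell2)
    have nn: "0 \<le> hnorm ell2 f" using sf f by (simp add: ell2_hnorm suminf_nonneg)
    have "(\<Sum>n<N. (cmod (weighted_shift \<alpha> f n))\<^sup>2) \<le> (B * hnorm ell2 f)\<^sup>2" for N
    proof (cases N)
      case (Suc M)
      have "(\<Sum>n<N. (cmod (weighted_shift \<alpha> f n))\<^sup>2) = (\<Sum>n<M. (\<alpha> n)\<^sup>2 * (cmod (f n))\<^sup>2)"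
        unfolding Suc sum.lessThan_Suc_shift
        by (simp add: weighted_shift_def norm_mult power_mult_distrib)
      also have "\<dots> \<le> (\<Sum>n<M. B\<^sup>2 * (cmod (f n))\<^sup>2)"
        using B B0 by (intro sum_mono mult_right_mono) (auto simp: power2_le_iff_abs_le)
      also have "\<dots> \<le> B\<^sup>2 * (hnorm ell2 f)\<^sup>2"
        using ell2_norm_bound_iff[OF nn, of f] f
        by (auto simp: sum_distrib_left[symmetric] intro!: mult_left_mono)
      finally show ?thesis by (simp add: power_mult_distrib)
    qed simp
    then show ?thesis using ell2_norm_bound_iff[of "B * hnorm ell2 f"] B0 nn by simp
  qed
  then have "linear_map ell2 ell2 (weighted_shift \<alpha>)"
    by (auto simp: linear_map_def add_ell2 smult_ell2 weighted_shift_def fun_eq_iff algebra_simps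
        split: nat.split)
  with bnd show ?thesis unfolding bounded_operator_def by blast
qed

text \<open>The image is closed because an isometry reflects Cauchy sequences and \<open>ell2\<close> is complete.\<close>

lemma image_isometry_closed_subspace:
  assumes lin: "linear_map ell2 ell2 U"
    and iso: "\<And>f g. f \<in> carrier ell2 \<Longrightarrow> g \<in> carrier ell2 \<Longrightarrow> cinner ell2 (U f) (U g) = cinner ell2 f g"
  shows "closed_subspace ell2 (U ` carrier ell2)"
    and "unitary_map ell2 (ell2\<lparr>carrier := U ` carrier ell2\<rparr>) U"
proof -
  interpret V: Module.module complex_ring ell2 by (rule module_ell2)
  interpret E: Metric_space "carrier ell2" "hdist ell2" by (rule Metric_space_ell2)
  have mem: "U f \<in> carrier ell2" if "f \<in> carrier ell2" for f
    using lin that by (auto simp: linear_map_def)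
  have plus: "U (f \<oplus>\<^bsub>ell2\<^esub> g) = U f \<oplus>\<^bsub>ell2\<^esub> U g" if "f \<in> carrier ell2" "g \<in> carrier ell2" for f g
    using lin that by (auto simp: linear_map_def)
  have scal: "U (z \<odot>\<^bsub>ell2\<^esub> f) = z \<odot>\<^bsub>ell2\<^esub> U f" if "f \<in> carrier ell2" for z f
    using lin that by (auto simp: linear_map_def)
  have sm_carrier: "z \<odot>\<^bsub>ell2\<^esub> f \<in> carrier ell2" if "f \<in> carrier ell2" for z f
    using V.smult_closed[of z f] that by (simp add: complex_ring_def)
  have neg: "\<ominus>\<^bsub>ell2\<^esub> f = (-1) \<odot>\<^bsub>ell2\<^esub> f" if "f \<in> carrier ell2" for f
  proof -
    have "(-1) \<odot>\<^bsub>ell2\<^esub> f \<oplus>\<^bsub>ell2\<^esub> f = \<zero>\<^bsub>ell2\<^esub>" by (simp add: ell2_def)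
    then show ?thesis using that sm_carrier by (intro V.M.minus_equality)
  qed
  have minus: "U (f \<ominus>\<^bsub>ell2\<^esub> g) = U f \<ominus>\<^bsub>ell2\<^esub> U g" if "f \<in> carrier ell2" "g \<in> carrier ell2" for f g
    using that by (simp add: a_minus_def neg plus scal sm_carrier mem)
  have dist: "hdist ell2 (U f) (U g) = hdist ell2 f g" if "f \<in> carrier ell2" "g \<in> carrier ell2" for f g
    using that mem iso[of "f \<ominus>\<^bsub>ell2\<^esub> g" "f \<ominus>\<^bsub>ell2\<^esub> g"]
    by (simp add: hdist_def hnorm_def minus[symmetric])
  have "submodule (U ` carrier ell2) complex_ring ell2"
  proof (rule V.submoduleI)
    show "U ` carrier ell2 \<subseteq> carrier ell2" using mem by blast
    have "U \<zero>\<^bsub>ell2\<^esub> = \<zero>\<^bsub>ell2\<^esub>"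
      using scal[OF V.M.zero_closed, of 0] unfolding smult_ell2 by (simp add: ell2_def)
    then show "\<zero>\<^bsub>ell2\<^esub> \<in> U ` carrier ell2" using imageI[OF V.M.zero_closed, of U] by simp
    show "\<ominus>\<^bsub>ell2\<^esub> x \<in> U ` carrier ell2" if x: "x \<in> U ` carrier ell2" for x
    proof -
      obtain f where f: "x = U f" "f \<in> carrier ell2" using x by blast
      then have "\<ominus>\<^bsub>ell2\<^esub> x = U ((-1) \<odot>\<^bsub>ell2\<^esub> f)" by (simp only: neg mem scal)
      then show ?thesis using imageI[OF sm_carrier[OF f(2)], of U] by simp
    qed
    show "x \<oplus>\<^bsub>ell2\<^esub> y \<in> U ` carrier ell2" if xy: "x \<in> U ` carrier ell2" "y \<in> U ` carrier ell2" for x y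
    proof -
      obtain f where f: "x = U f" "f \<in> carrier ell2" using xy by blast
      obtain g where g: "y = U g" "g \<in> carrier ell2" using xy by blast
      from f g have "x \<oplus>\<^bsub>ell2\<^esub> y = U (f \<oplus>\<^bsub>ell2\<^esub> g)" by (simp only: plus)
      then show ?thesis using imageI[OF V.M.a_closed[OF f(2) g(2)], of U] by simp
    qed
    show "z \<odot>\<^bsub>ell2\<^esub> x \<in> U ` carrier ell2" if "z \<in> carrier complex_ring" and x: "x \<in> U ` carrier ell2" for z x
    proof -
      obtain f where f: "x = U f" "f \<in> carrier ell2" using x by blast
      then have "z \<odot>\<^bsub>ell2\<^esub> x = U (z \<odot>\<^bsub>ell2\<^esub> f)" by (simp only: scal)
      then show ?thesis using imageI[OF sm_carrier[OF f(2)], of U] by simp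
    qed
  qed
  moreover have "closedin E.mtopology (U ` carrier ell2)"
    unfolding E.metric_closedin_iff_sequentially_closed
  proof (intro conjI allI impI)
    show "U ` carrier ell2 \<subseteq> carrier ell2" using mem by blast
    fix \<sigma> l assume A: "range \<sigma> \<subseteq> U ` carrier ell2 \<and> limitin E.mtopology \<sigma> l sequentially"
    then have "\<forall>n. \<exists>f. f \<in> carrier ell2 \<and> \<sigma> n = U f" by blast
    then obtain \<tau> where \<tau>: "\<And>n. \<tau> n \<in> carrier ell2" "\<And>n. \<sigma> n = U (\<tau> n)" by metis
    have "E.MCauchy \<sigma>"
      using A \<tau> mem by (intro E.convergent_imp_MCauchy) auto
    then have "E.MCauchy \<tau>"
      using \<tau> dist by (auto simp: E.MCauchy_def)
    then obtain f where f: "limitin E.mtopology \<tau> f sequentially"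
      using mcomplete_ell2 unfolding E.mcomplete_def by blast
    then have fc: "f \<in> carrier ell2" by (simp add: E.limitin_metric)
    then have "limitin E.mtopology \<sigma> (U f) sequentially"
      using f \<tau> dist mem by (simp add: E.limitin_metric)
    then have "l = U f"
      using A E.limitin_metric_unique[of \<sigma> l sequentially "U f"] by auto
    then show "l \<in> U ` carrier ell2" using fc by blast
  qed
  ultimately show "closed_subspace ell2 (U ` carrier ell2)"
    by (simp add: closed_subspace_def)
  have "inj_on U (carrier ell2)"
  proof (rule inj_onI)
    fix f g assume A: "f \<in> carrier ell2" "g \<in> carrier ell2" "U f = U g"
    then have "hdist ell2 f g = 0" using dist[of f g] mem by simp
    then show "f = g" using A by simp
  qed
  then show "unitary_map ell2 (ell2\<lparr>carrier := U ` carrier ell2\<rparr>) U"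
    using lin iso by (auto simp: unitary_map_def linear_map_def bij_betw_def)
qed

section \<open>Normal extensions from orbits of Jacobi matrices\<close>

text \<open>Sends the basis vector \<open>n\<close> to the vector \<open>v n\<close> placed in the fibre over \<open>n\<close>.\<close>

definition fibre_embedding :: "(nat \<Rightarrow> int \<Rightarrow> real) \<Rightarrow> (nat \<Rightarrow> complex) \<Rightarrow> nat \<Rightarrow> complex" where
  "fibre_embedding v f n = (case decode n of (m, k) \<Rightarrow>
     if m < 0 then 0 else f (nat m) * of_real (v (nat m) k))"

lemma fibre_embedding_code:
  "fibre_embedding v f (code (m, k)) = (if m < 0 then 0 else f (nat m) * of_real (v (nat m) k))"
  by (simp add: fibre_embedding_def)

text \<open>Summing each fibre first gives \<open>F n\<close>, because \<open>v n\<close> is a unit vector. Absolute convergence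
  allows the rearrangement into the order of the enumeration.\<close>

lemma fibre_embedding_sums:
  assumes v: "\<And>n. ((\<lambda>k. (v n k)\<^sup>2) has_sum 1) UNIV"
    and F: "summable (\<lambda>n. norm (F n :: complex))"
  shows "(\<lambda>n. case decode n of (m, k) \<Rightarrow> if m < 0 then 0 else F (nat m) * of_real ((v (nat m) k)\<^sup>2))
    sums (\<Sum>n. F n)"
proof -
  define G where "G = (\<lambda>(n, k). F n * of_real ((v n k)\<^sup>2))"
  have row: "((\<lambda>k. G (n, k)) has_sum F n) UNIV" for n
    using has_sum_cmult_right[OF has_sum_of_real[OF v, where 'a = complex], of "F n"] by (simp add: G_def)
  have nrow: "((\<lambda>k. norm (G (n, k))) has_sum norm (F n)) UNIV" for n
    using has_sum_cmult_right[OF v, of "norm (F n)"] by (simp add: G_def norm_mult norm_power)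
  have abs: "(\<lambda>x. norm (G x)) summable_on Sigma UNIV (\<lambda>_. UNIV)"
    unfolding Infinite_Sum.abs_summable_on_Sigma_iff
  proof (intro conjI ballI)
    show "(\<lambda>k. norm (G (n, k))) summable_on UNIV" for n
      using nrow has_sum_imp_summable by blast
    have "(\<lambda>n. norm (F n)) summable_on UNIV" using F by (simp add: summable_on_UNIV_nonneg_real_iff)
    then show "(\<lambda>n. norm (infsum (\<lambda>k. norm (G (n, k))) UNIV)) summable_on UNIV"
      using infsumI[OF nrow] by simp
  qed
  have tot: "(F has_sum (\<Sum>n. F n)) UNIV"
    using F summable_norm_cancel[OF F] by (intro norm_summable_imp_has_sum summable_sums)
  have "(G has_sum (\<Sum>n. F n)) (Sigma UNIV (\<lambda>_. UNIV))"
    by (rule has_sum_SigmaI[OF row tot abs_summable_summable[OF abs]])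
  also have "?this \<longleftrightarrow> ((\<lambda>(m, k). G (nat m, k)) has_sum (\<Sum>n. F n)) ({0..} \<times> UNIV)"
    by (rule has_sum_reindex_bij_witness[where i = "\<lambda>(m, k). (nat m, k)" and j = "\<lambda>(n, k). (int n, k)"])
      auto
  also have "\<dots> \<longleftrightarrow> ((\<lambda>(m, k). if m < 0 then 0 else G (nat m, k)) has_sum (\<Sum>n. F n)) UNIV"
    by (rule has_sum_cong_neutral) (auto split: if_splits)
  also have "\<dots> \<longleftrightarrow> ((\<lambda>n. case decode n of (m, k) \<Rightarrow> if m < 0 then 0 else G (nat m, k))
      has_sum (\<Sum>n. F n)) UNIV"
    by (rule has_sum_reindex_bij_witness[where i = decode and j = code]) auto
  finally have "(\<lambda>n. case decode n of (m, k) \<Rightarrow> if m < 0 then 0 else G (nat m, k)) sums (\<Sum>n. F n)"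
    by (rule has_sum_imp_sums)
  then show ?thesis by (simp add: G_def cong: if_cong)
qed

lemma fibre_embedding_isometry:
  assumes v: "\<And>n. ((\<lambda>k. (v n k)\<^sup>2) has_sum 1) UNIV"
  shows "linear_map ell2 ell2 (fibre_embedding v)"
    and "\<And>f g. f \<in> carrier ell2 \<Longrightarrow> g \<in> carrier ell2 \<Longrightarrow>
      cinner ell2 (fibre_embedding v f) (fibre_embedding v g) = cinner ell2 f g"
proof -
  have inner: "(\<lambda>n. fibre_embedding v f n * cnj (fibre_embedding v g n)) sums cinner ell2 f g"
    if "f \<in> carrier ell2" "g \<in> carrier ell2" for f g
  proof -
    have "summable (\<lambda>n. norm (f n * cnj (g n)))"
      using that ell2_summable_cinner[of "\<lambda>n. of_real (cmod (f n))" "\<lambda>n. of_real (cmod (g n))"]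
      by (simp add: carrier_ell2 norm_mult summable_of_real_iff flip: of_real_mult)
    moreover have "fibre_embedding v f n * cnj (fibre_embedding v g n) = (case decode n of (m, k) \<Rightarrow>
        if m < 0 then 0 else f (nat m) * cnj (g (nat m)) * of_real ((v (nat m) k)\<^sup>2))" for n
      by (simp add: fibre_embedding_def power2_eq_square split_beta)
    ultimately show ?thesis
      using fibre_embedding_sums[where v = v, OF v] by (simp add: cinner_ell2)
  qed
  have "fibre_embedding v f \<in> carrier ell2" if "f \<in> carrier ell2" for f
  proof -
    have "(\<lambda>n. fibre_embedding v f n * cnj (fibre_embedding v f n))
        = (\<lambda>n. of_real ((cmod (fibre_embedding v f n))\<^sup>2))"
      by (intro ext) (rule complex_norm_square[symmetric])
    then show ?thesis
      using sums_summable[OF inner[OF that that]]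
      by (simp add: carrier_ell2 summable_of_real_iff del: of_real_power)
  qed
  then show "linear_map ell2 ell2 (fibre_embedding v)"
    by (auto simp: linear_map_def add_ell2 smult_ell2 fibre_embedding_def fun_eq_iff algebra_simps
        split: prod.split)
  show "cinner ell2 (fibre_embedding v f) (fibre_embedding v g) = cinner ell2 f g"
    if "f \<in> carrier ell2" "g \<in> carrier ell2" for f g
    using sums_unique[OF inner[OF that]] by (simp add: cinner_ell2)
qed

text \<open>The hypothesis \<open>step\<close> says that the Jacobi matrix maps the unit vector \<open>v n\<close> to \<open>\<alpha> n\<close> times the
  unit vector \<open>v (n + 1)\<close>. Placed in consecutive fibres, these vectors are orthonormal, and the normal
  operator acts on them as the weighted shift.\<close>

lemma subnormal_if_jacobi_orbit:
  fixes \<alpha> :: "nat \<Rightarrow> real" and a b :: "int \<Rightarrow> real" and v :: "nat \<Rightarrow> int \<Rightarrow> real"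
  assumes \<alpha>: "\<And>n. \<bar>\<alpha> n\<bar> \<le> B"
    and a: "\<And>k. \<bar>a k\<bar> \<le> B" and b: "\<And>k. \<bar>b k\<bar> \<le> B"
    and v: "\<And>n. ((\<lambda>k. (v n k)\<^sup>2) has_sum 1) UNIV"
    and step: "\<And>n k. \<alpha> n * v (Suc n) k = b (k - 1) * v n (k - 1) + a k * v n k + b k * v n (k + 1)"
  shows "subnormal_operator ell2 (weighted_shift \<alpha>)"
proof -
  define U where "U = fibre_embedding v"
  define M where "M = U ` carrier ell2"
  note iso = fibre_embedding_isometry[where v = v, OF v, folded U_def]
  note cl = image_isometry_closed_subspace[OF iso, folded M_def]
  have W: "bounded_operator ell2 (weighted_shift \<alpha>)"
    by (rule bounded_operator_weighted_shift[OF \<alpha>])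
  have inter: "U (weighted_shift \<alpha> f) = jacobi_shift a b (U f)" for f
  proof
    fix n
    obtain m k where n: "n = code (m, k)" by (metis code_decode surj_pair)
    have "\<exists>j. m = int (Suc j)" if "m > 0"
      using that by (intro exI[of _ "nat m - 1"]) simp
    then consider "m < 0" | "m = 0" | j where "m = int (Suc j)"
      using linorder_cases[of m 0] by blast
    then show "U (weighted_shift \<alpha> f) n = jacobi_shift a b (U f) n"
    proof cases
      case 3
      have "U (weighted_shift \<alpha> f) n = f j * of_real (\<alpha> j * v (Suc j) k)"
        by (simp add: n 3 U_def fibre_embedding_code weighted_shift_def nat_add_distrib)
      also have "\<dots> = jacobi_shift a b (U f) n"
        unfolding step
        by (simp add: n 3 U_def fibre_embedding_code jacobi_shift_def weighted_translation_code
            algebra_simps)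
      finally show ?thesis .
    qed (simp_all add: n U_def fibre_embedding_code jacobi_shift_def weighted_translation_code
        weighted_shift_def)
  qed
  have "jacobi_shift a b ` M \<subseteq> M"
    using W by (auto simp: M_def bounded_operator_def linear_map_def inter[symmetric])
  then have "hilbert_space ell2 \<and> normal_operator ell2 (jacobi_shift a b) \<and> closed_subspace ell2 M \<and>
      jacobi_shift a b ` M \<subseteq> M \<and> unitary_map ell2 (ell2\<lparr>carrier := M\<rparr>) U \<and>
      (\<forall>f\<in>carrier ell2. U (weighted_shift \<alpha> f) = jacobi_shift a b (U f))"
    by (simp add: hilbert_space_ell2 normal_jacobi_shift[OF a b] cl inter)
  then show ?thesis
    unfolding subnormal_operator_def by (intro conjI[OF W] exI)
qed

section \<open>Log completely alternating weights\<close>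

text \<open>With \<open>s\<close> a bound for the weights, the normalised moments
  \<open>g n = (\<Prod>k<n. (\<alpha> k / s)\<^sup>2)\<close> are \<open>exp (- \<psi> n)\<close>, and the first difference of \<open>\<psi>\<close> is
  \<open>2 * ln (\<alpha> k) - 2 * ln s\<close>. The hypothesis on \<open>\<alpha>\<close> controls the differences of \<open>\<psi>\<close> of order at least
  2, and \<open>\<alpha> k \<le> s\<close> those of order 1.\<close>

lemma normalised_moments_completely_monotone:
  assumes pos: "\<And>n. 0 < \<alpha> n" and le: "\<And>n. \<alpha> n \<le> s" and alt: "log_completely_alternating \<alpha>"
  shows "0 \<le> (nabla ^^ n) (\<lambda>n. \<Prod>k<n. (\<alpha> k / s)\<^sup>2) k"
proof -
  define \<psi> where "\<psi> n = - (\<Sum>k<n. 2 * ln (\<alpha> k) + (- 2 * ln s))" for n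
  have s: "0 < s" using pos[of 0] le[of 0] by linarith
  have exp: "(\<Prod>k<n. (\<alpha> k / s)\<^sup>2) = exp (- \<psi> n)" for n
  proof -
    have "exp (2 * ln (\<alpha> k) + (- 2 * ln s)) = (\<alpha> k / s)\<^sup>2" for k
    proof -
      have "2 * ln (\<alpha> k) + (- 2 * ln s) = ln ((\<alpha> k / s)\<^sup>2)"
        using pos[of k] s by (simp add: ln_div ln_realpow)
      then show ?thesis using pos[of k] s by simp
    qed
    then show ?thesis by (simp add: \<psi>_def exp_sum del: mult_minus_left)
  qed
  have "(nabla ^^ m) \<psi> k \<le> 0" if m: "m \<ge> 1" for m k
  proof -
    obtain j where j: "m = Suc j" using m by (cases m) auto
    have "nabla \<psi> = (\<lambda>k. 2 * ln (\<alpha> k) + (- 2 * ln s))"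
      by (simp add: nabla_def \<psi>_def fun_eq_iff)
    then have eq: "(nabla ^^ m) \<psi> k = (nabla ^^ j) (\<lambda>k. 2 * ln (\<alpha> k) + (- 2 * ln s)) k"
      by (simp add: j funpow_Suc_right del: funpow.simps)
    show ?thesis
    proof (cases "j = 0")
      case True
      then show ?thesis using eq pos[of k] le[of k] by simp
    next
      case False
      then have "(nabla ^^ j) (\<lambda>k. ln (\<alpha> k)) k \<le> 0"
        using alt by (simp add: log_completely_alternating_def nabla_pow_eq_binomial_sum)
      then show ?thesis
        using False unfolding eq nabla_pow_add nabla_pow_cmult by (simp add: nabla_pow_const)
    qed
  qed
  then show ?thesis unfolding exp by (rule completely_monotone_exp_minus)
qed

text \<open>By Parseval, the \<open>n\<close>-th orbit vector \<open>c n\<close> of the Jacobi matrix has squared norm \<open>\<Lambda> (X ^ (2 * n))\<close>.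
  The functional is chosen such that this is \<open>(\<Prod>k<n. \<alpha> k)\<^sup>2\<close>, so normalising the orbit produces exactly
  the factors \<open>\<alpha> n\<close>.\<close>

lemma subnormal_weighted_shift_if_log_completely_alternating:
  assumes pos: "\<And>n. 0 < \<alpha> n" and le: "\<And>n. \<alpha> n \<le> s" and alt: "log_completely_alternating \<alpha>"
  shows "subnormal_operator ell2 (weighted_shift \<alpha>)"
proof -
  define g where "g n = (\<Prod>k<n. (\<alpha> k / s)\<^sup>2)" for n
  define h where "h n = (if even n then s ^ n * g (n div 2) else 0)" for n
  have s: "0 < s" using pos[of 0] le[of 0] by linarith
  have cm: "0 \<le> (nabla ^^ n) g k" for n k
    unfolding g_def by (rule normalised_moments_completely_monotone[OF pos le alt])
  have nonneg: "0 \<le> moment_functional h f" if "\<And>x. \<bar>x\<bar> \<le> s \<Longrightarrow> 0 \<le> poly f x" for f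
    unfolding h_def by (rule symmetric_moment_functional_nonneg[OF cm _ that]) (use s in auto)
  interpret positive_functional "moment_functional h" s
  proof
    show "moment_functional h (p + q) = moment_functional h p + moment_functional h q" for p q
      by (rule moment_functional_add)
    show "moment_functional h (Polynomial.smult c p) = c * moment_functional h p" for c p
      by (rule moment_functional_smult)
    show "0 \<le> moment_functional h (p * p)" for p
      by (rule nonneg) simp
    show "moment_functional h 1 = 1"
      using moment_functional_monom[of h 1 0] by (simp add: h_def g_def)
    show "moment_functional h (monom 1 1 * p * (monom 1 1 * p)) \<le> s\<^sup>2 * moment_functional h (p * p)" for p
    proof -
      have "0 \<le> poly (Polynomial.smult (s\<^sup>2) (p * p) - monom 1 1 * p * (monom 1 1 * p)) x" if "\<bar>x\<bar> \<le> s" for x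
      proof -
        have "x\<^sup>2 \<le> s\<^sup>2" using that s by (simp add: power2_le_iff_abs_le)
        then have "0 \<le> (s\<^sup>2 - x\<^sup>2) * (poly p x)\<^sup>2" by simp
        then show ?thesis by (simp add: poly_monom algebra_simps power2_eq_square)
      qed
      from nonneg[OF this] show ?thesis
        by (simp add: moment_functional_diff moment_functional_smult)
    qed
  qed
  define P where "P n = (\<Prod>k<n. \<alpha> k)" for n
  have P: "0 < P n" for n by (simp add: P_def pos prod_pos)
  have norm: "(\<Sum>k\<le>Suc n. (c n k)\<^sup>2) = (P n)\<^sup>2" for n
  proof -
    have "(\<Sum>k\<le>Suc n. (c n k)\<^sup>2) = moment_functional h (monom 1 (2 * n))"
      unfolding parseval by (simp add: monom_power)
    also have "\<dots> = (s ^ n)\<^sup>2 * g n"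
      by (simp add: moment_functional_monom h_def power_mult mult.commute[of 2])
    also have "\<dots> = (P n)\<^sup>2"
      using s by (simp add: g_def P_def prod_power_distrib[symmetric] prod_dividef power_divide
          mult.commute[of 2] flip: power_mult)
    finally show ?thesis .
  qed
  \<comment> \<open>The Jacobi matrix and the orbit of its first basis vector are extended by zero to indices in
    \<open>int\<close>. This is consistent with the recurrence, since \<open>a\<close>, \<open>b\<close> and \<open>c n\<close> vanish at 0.\<close>
  define a' where "a' k = (if k < 0 then 0 else a (nat k))" for k :: int
  define b' where "b' k = (if k < 0 then 0 else b (nat k))" for k :: int
  define v where "v n k = (if k < 0 then 0 else c n (nat k)) / P n" for n and k :: int
  show ?thesis
  proof (rule subnormal_if_jacobi_orbit)
    show "\<bar>\<alpha> n\<bar> \<le> s" for n using pos[of n] le[of n] by simp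
    show "\<bar>a' k\<bar> \<le> s" "\<bar>b' k\<bar> \<le> s" for k
      using a_bound[of "nat k"] b_bound[of "nat k"] s by (auto simp: a'_def b'_def)
    show "((\<lambda>k. (v n k)\<^sup>2) has_sum 1) UNIV" for n
    proof (rule has_sum_finite_neutralI)
      show "finite (int ` {..Suc n})" by simp
      have "(\<Sum>k\<in>int ` {..Suc n}. (v n k)\<^sup>2) = (\<Sum>k\<le>Suc n. (c n k)\<^sup>2) / (P n)\<^sup>2"
        by (subst sum.reindex) (simp_all only: v_def inj_on_of_nat o_def of_nat_less_0_iff if_False
            nat_int power_divide sum_divide_distrib)
      also have "\<dots> = 1" using P[of n] unfolding norm by simp
      finally show "1 = (\<Sum>k\<in>int ` {..Suc n}. (v n k)\<^sup>2)" by simp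
      show "(v n k)\<^sup>2 = 0" if "k \<in> UNIV - int ` {..Suc n}" for k
      proof (cases "k < 0")
        case False
        then have "nat k > Suc n"
          using that by (metis DiffD2 atMost_iff imageI int_nat_eq linorder_not_less)
        then show ?thesis by (simp add: v_def c_support)
      qed (simp add: v_def)
    qed simp
    show "\<alpha> n * v (Suc n) k = b' (k - 1) * v n (k - 1) + a' k * v n k + b' k * v n (k + 1)" for n k
    proof -
      have "\<alpha> n * v (Suc n) k = (if k < 0 then 0 else c (Suc n) (nat k)) / P n"
        using pos[of n] P[of n] by (simp add: v_def P_def)
      also have "(if k < 0 then 0 else c (Suc n) (nat k))
          = b' (k - 1) * (if k - 1 < 0 then 0 else c n (nat (k - 1)))
            + a' k * (if k < 0 then 0 else c n (nat k))
            + b' k * (if k + 1 < 0 then 0 else c n (nat (k + 1)))"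
      proof -
        consider "k < 0" | "k = 0" | "k > 0" by linarith
        then show ?thesis
        proof cases
          case 3
          then have "nat (k - 1) = nat k - 1" "nat (k + 1) = Suc (nat k)" by simp_all
          then show ?thesis using 3 by (simp add: a'_def b'_def c_Suc)
        qed (simp_all add: a'_def b'_def)
      qed
      finally show ?thesis by (simp add: v_def add_divide_distrib)
    qed
  qed
qed

theorem theorem3p5:
  fixes \<alpha> :: "nat \<Rightarrow> real"
  assumes pos: "\<And>n. 0 < \<alpha> n"
    and bdd: "bounded (range \<alpha>)"
  shows "(log_completely_alternating \<alpha> \<longleftrightarrow> log_completely_alternating (\<lambda>n. (\<alpha> n)\<^sup>2)) \<and>
    (log_completely_alternating \<alpha> \<longrightarrow>
       moment_infinitely_divisible \<alpha> \<and> subnormal_operator ell2 (weighted_shift \<alpha>))"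
proof (intro conjI impI)
  have "(\<Sum>i=0..n. (-1) ^ i * real (n choose i) * ln ((\<alpha> (k + i))\<^sup>2))
      = 2 * (\<Sum>i=0..n. (-1) ^ i * real (n choose i) * ln (\<alpha> (k + i)))" for n k
    using pos by (simp add: ln_realpow sum_distrib_left mult_ac)
  then show "log_completely_alternating \<alpha> \<longleftrightarrow> log_completely_alternating (\<lambda>n. (\<alpha> n)\<^sup>2)"
    by (simp add: log_completely_alternating_def)
next
  assume alt: "log_completely_alternating \<alpha>"
  obtain s where s: "\<And>n. \<alpha> n \<le> s"
    using bdd by (auto simp: bounded_iff dest: abs_le_D1)
  show "subnormal_operator ell2 (weighted_shift \<alpha>)"
    by (rule subnormal_weighted_shift_if_log_completely_alternating[OF pos s alt])
  show "moment_infinitely_divisible \<alpha>"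
    unfolding moment_infinitely_divisible_def
  proof (intro allI impI)
    fix p :: real
    assume p: "0 \<le> p"
    have "(\<Sum>i=0..n. (-1) ^ i * real (n choose i) * ln (\<alpha> (k + i) powr p))
        = p * (\<Sum>i=0..n. (-1) ^ i * real (n choose i) * ln (\<alpha> (k + i)))" for n k
      using pos by (simp add: ln_powr less_imp_neq[THEN not_sym] sum_distrib_left mult_ac)
    then have "log_completely_alternating (\<lambda>n. \<alpha> n powr p)"
      using alt p by (simp add: log_completely_alternating_def mult_nonneg_nonpos)
    moreover have "\<alpha> n powr p \<le> s powr p" for n
      using pos[of n] s[of n] p by (intro powr_mono2) auto
    moreover have "0 < \<alpha> n powr p" for n using pos[of n] by simp
    ultimately show "subnormal_operator ell2 (weighted_shift (\<lambda>n. \<alpha> n powr p))"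
      by (intro subnormal_weighted_shift_if_log_completely_alternating)
  qed
qed

end
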